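(* Let $v\in \mathcal{C}^2(\mathbb{H})$ and let $q\in\mathbb{H}$. If $\nabla_{\mathbb{H}}v(q)\neq 0$, then the following expansions are valid as $r\to 0$. (i) For $p>1$ define $\alpha_p=\frac{3\pi}{2(p-2)+3\pi}$ and $\beta_p=\frac{2(p-2)}{2(p-2)+3\pi}$. Then $$\alpha_p\mathcal{A}_3(v,r)(q)+\frac{\beta_p}{2}\Big(\inf_{q'\in B_r(q)}v(q')+\sup_{q'\in B_r(q)}v(q')\Big)=v(q)+\frac{r^2}{2(p-2)+3\pi}\cdot\frac{\Delta_{\mathbb{H},p}v(q)}{|\nabla_{\mathbb{H}}v(q)|^{p-2}}+o(r^2).$$ In particular, for $p=2$ one recovers the harmonic expansion $\mathcal{A}_3(v,r)(q)=v(q)+\frac{r^2}{3\pi}\Delta_{\mathbb{H}}v(q)+o(r^2)$. (ii) For $p>2$ define $\gamma_p=\big(\frac{p-2}{\pi}\big)^{1/2}$. Then $$\frac13\mathcal{A}_3(v,r)(q)+\frac13\inf_{q'\in B_{\gamma_p r}(q)}\mathcal{A}_3(v,r)(q')+\frac13\sup_{q'\in B_{\gamma_p r}(q)}\mathcal{A}_3(v,r)(q')=v(q)+\frac{r^2}{3\pi}\cdot\frac{\Delta_{\mathbb{H},p}v(q)}{|\nabla_{\mathbb{H}}v(q)|^{p-2}}+o(r^2).$$ Again, the harmonic expansion $\mathcal{A}_3(v,r)(q)=v(q)+\frac{r^2}{3\pi}\Delta_{\mathbb{H}}v(q)+o(r^2)$ is recovered asymptotically as $p\to 2^+$.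
   Context: $\mathbb{H}=(\mathbb{R}^3,* )$ is the first Heisenberg group with $(x,y,z)*(x',y',z')=(x+x',y+y',z+z'+\frac12(xy'-yx'))$. The Korányi gauge is $|(x,y,z)|_K=((x^2+y^2)^2+16z^2)^{1/4}$, the metric is $d(q,q')=|q^{-1}*q'|_K$, and $B_r(q)=\{q'\in\mathbb{H}: d(q,q')<r\}$. With $X=\partial_x-\frac y2\partial_z$, $Y=\partial_y+\frac x2\partial_z$, the horizontal gradient is $\nabla_{\mathbb{H}}v=(Xv,Yv)$, the sub-Laplacian is $\Delta_{\mathbb{H}}v=(X^2+Y^2)v$, and the $p$-sub-Laplacian is $\Delta_{\mathbb{H},p}v=X\big(|\nabla_{\mathbb{H}}v|^{p-2}Xv\big)+Y\big(|\nabla_{\mathbb{H}}v|^{p-2}Yv\big)$ for $p\in(1,\infty)$. For $r>0$ and continuous $v$, define the average $\mathcal{A}_3(v,r)(q)=\frac{1}{|B_r(q)|}\int_{B_r(q)}v(q')\,dq'$ (Lebesgue measure on $\mathbb{R}^3$). *)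

theory Defs
  imports "HOL-Analysis.Analysis" "HOL-Library.Landau_Symbols"
begin

type_synonym heis = "real \<times> real \<times> real"

fun heis_mult :: "heis \<Rightarrow> heis \<Rightarrow> heis" (infixl "\<odot>" 70) where
  "(x, y, z) \<odot> (x', y', z') = (x + x', y + y', z + z' + (x * y' - y * x') / 2)"

fun heis_inv :: "heis \<Rightarrow> heis" where
  "heis_inv (x, y, z) = (- x, - y, - z)"

lemma heis_assoc: "(a \<odot> b) \<odot> c = a \<odot> (b \<odot> c)"
  by (cases a; cases b; cases c) (simp add: field_simps)

lemma heis_unit: "(0, 0, 0) \<odot> a = a" "a \<odot> (0, 0, 0) = a"
  by (cases a; simp)+

lemma heis_inverse: "heis_inv a \<odot> a = (0, 0, 0)" "a \<odot> heis_inv a = (0, 0, 0)"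
  by (cases a; simp)+

fun koranyi :: "heis \<Rightarrow> real" where
  "koranyi (x, y, z) = root 4 ((x\<^sup>2 + y\<^sup>2)\<^sup>2 + 16 * z\<^sup>2)"

definition heis_dist :: "heis \<Rightarrow> heis \<Rightarrow> real" where
  "heis_dist q q' = koranyi (heis_inv q \<odot> q')"

definition heis_ball :: "real \<Rightarrow> heis \<Rightarrow> heis set" where
  "heis_ball r q = {q'. heis_dist q q' < r}"

text \<open>The vector fields \<open>X = \<partial>\<^sub>x - (y/2) \<partial>\<^sub>z\<close> and \<open>Y = \<partial>\<^sub>y + (x/2) \<partial>\<^sub>z\<close>, built from
  one-variable derivatives along the coordinate axes.\<close>

fun heis_X :: "(heis \<Rightarrow> real) \<Rightarrow> heis \<Rightarrow> real" where
  "heis_X v (x, y, z) = deriv (\<lambda>t. v (t, y, z)) x - y / 2 * deriv (\<lambda>t. v (x, y, t)) z"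

fun heis_Y :: "(heis \<Rightarrow> real) \<Rightarrow> heis \<Rightarrow> real" where
  "heis_Y v (x, y, z) = deriv (\<lambda>t. v (x, t, z)) y + x / 2 * deriv (\<lambda>t. v (x, y, t)) z"

definition hgrad :: "(heis \<Rightarrow> real) \<Rightarrow> heis \<Rightarrow> real \<times> real" where
  "hgrad v q = (heis_X v q, heis_Y v q)"

definition sublap :: "(heis \<Rightarrow> real) \<Rightarrow> heis \<Rightarrow> real" where
  "sublap v q = heis_X (heis_X v) q + heis_Y (heis_Y v) q"

text \<open>Although \<open>0 powr a = 0\<close> for every \<open>a\<close>, the convention never matters at \<open>p = 2\<close>: where the
  horizontal gradient vanishes, so do the factors \<open>heis_X v\<close> and \<open>heis_Y v\<close>.\<close>

definition p_sublap :: "real \<Rightarrow> (heis \<Rightarrow> real) \<Rightarrow> heis \<Rightarrow> real" where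
  "p_sublap p v q =
     heis_X (\<lambda>w. norm (hgrad v w) powr (p - 2) * heis_X v w) q +
     heis_Y (\<lambda>w. norm (hgrad v w) powr (p - 2) * heis_Y v w) q"

text \<open>Twice continuously (Frechet) differentiable on all of the underlying space
  \<open>\<real>\<^sup>3\<close>; \<open>D\<close> and \<open>D2\<close> are the first and second derivative.\<close>

definition C2_fun :: "(heis \<Rightarrow> real) \<Rightarrow> bool" where
  "C2_fun v \<longleftrightarrow>
     (\<exists>(D :: heis \<Rightarrow> heis \<Rightarrow>\<^sub>L real) (D2 :: heis \<Rightarrow> heis \<Rightarrow>\<^sub>L heis \<Rightarrow>\<^sub>L real).
        (\<forall>q. (v has_derivative blinfun_apply (D q)) (at q)) \<and>
        (\<forall>q. (D has_derivative blinfun_apply (D2 q)) (at q)) \<and>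
        continuous_on UNIV D2)"

definition avg3 :: "(heis \<Rightarrow> real) \<Rightarrow> real \<Rightarrow> heis \<Rightarrow> real" where
  "avg3 v r q =
     (1 / measure lborel (heis_ball r q)) * (LINT q':heis_ball r q|lborel. v q')"

definition alpha_p :: "real \<Rightarrow> real" where
  "alpha_p p = 3 * pi / (2 * (p - 2) + 3 * pi)"

definition beta_p :: "real \<Rightarrow> real" where
  "beta_p p = 2 * (p - 2) / (2 * (p - 2) + 3 * pi)"

definition gamma_p :: "real \<Rightarrow> real" where
  "gamma_p p = sqrt ((p - 2) / pi)"

text \<open>Left-hand sides of the two expansions. For \<open>r > 0\<close> (and \<open>p > 2\<close> in the second one) the balls are
  nonempty and bounded, so for continuous \<open>v\<close> the infima and suprema are genuine.\<close>

definition mean_i :: "real \<Rightarrow> (heis \<Rightarrow> real) \<Rightarrow> real \<Rightarrow> heis \<Rightarrow> real" where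
  "mean_i p v r q =
     alpha_p p * avg3 v r q +
     beta_p p / 2 * ((INF q'\<in>heis_ball r q. v q') + (SUP q'\<in>heis_ball r q. v q'))"

definition mean_ii :: "real \<Rightarrow> (heis \<Rightarrow> real) \<Rightarrow> real \<Rightarrow> heis \<Rightarrow> real" where
  "mean_ii p v r q =
     1 / 3 * avg3 v r q +
     1 / 3 * (INF q'\<in>heis_ball (gamma_p p * r) q. avg3 v r q') +
     1 / 3 * (SUP q'\<in>heis_ball (gamma_p p * r) q. avg3 v r q')"

definition harmonic_expansion :: "(heis \<Rightarrow> real) \<Rightarrow> heis \<Rightarrow> bool" where
  "harmonic_expansion v q \<longleftrightarrow>
     (\<lambda>r. avg3 v r q - (v q + r\<^sup>2 / (3 * pi) * sublap v q)) \<in> o[at_right 0](\<lambda>r. r\<^sup>2)"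

end

theory Submission
  imports Defs
begin

text \<open>
  On a small ball around \<open>q\<close> one has, with \<open>u = (a, b, c)\<close>,
  \<open>v (q \<odot> u) = v q + A a + B b + C c + (P a\<^sup>2 + R a b + S b\<^sup>2) / 2 + o(r\<^sup>2)\<close>, where \<open>(A, B)\<close> is the
  horizontal gradient and \<open>P\<close>, \<open>R\<close>, \<open>S\<close> are the second horizontal derivatives
  \<open>XXv\<close>, \<open>XYv + YXv\<close>, \<open>YYv\<close>, all at \<open>q\<close>. By symmetry only \<open>P\<close> and \<open>S\<close> survive
  averaging, and the second moments of the Koranyi ball produce the factor \<open>1 / (3 \<pi>)\<close>.
  Writing \<open>N = |(A, B)|\<close>, the supremum of the polynomial is attained up to \<open>O(r\<^sup>3)\<close> at the horizontal
  point \<open>r (A, B) / N\<close>, because moving away from it costs \<open>N\<close> times the distance, which dominates the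
  gain from the vertical and quadratic terms. So the infimum and the supremum average to the second
  derivative in the direction of the gradient, the normalized infinity-Laplacian. Both expansions are linear
  combinations of these two facts, the second one using that the averages are uniform in the centre.
\<close>

section \<open>Lebesgue measure and the group structure\<close>

text \<open>The obstacle sits in the second expansion: the function being extremized,
  \<open>avg3 v r\<close>, itself changes with \<open>r\<close> and is evaluated at centres other
  than \<open>q\<close>. Two uniformities deal with this. \<open>Sup_heis_ball_jet\<close> yields
  one threshold for every function that is \<open>\<epsilon> * r\<^sup>2\<close>-close to a given
  jet. \<open>heis_taylor\<close> takes the first-order coefficients at the moving centre
  \<open>w\<close> but freezes the second-order ones at \<open>q\<close>, so the correction
  \<open>avg3 v r w - v w\<close> is, up to \<open>o(r^2)\<close>, independent of \<open>w\<close>;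
  extremizing the average then amounts to extremizing \<open>v\<close> plus a constant. Constants:
  second moment over volume is \<open>(pi r^6 / 12) / (pi^2 r^4 / 8) = 2 r^2 / (3 pi)\<close>, and
  the Taylor factor 1/2 leaves \<open>r^2 / (3 pi)\<close>. The normalized p-sub-Laplacian equals
  \<open>P + S + (p - 2) H\<close>, with \<open>H\<close> the second derivative along the gradient.
  With \<open>T = 2 (p - 2) + 3 pi\<close> this dictates \<open>alpha_p / (3 pi) = 1 / T\<close> and
  \<open>beta_p / 2 = (p - 2) / T\<close>; in the second expansion it dictates
  \<open>gamma_p^2 / 3 = (p - 2) / (3 pi)\<close>.\<close>

lemma nn_integral_heis:
  assumes [measurable]: "f \<in> borel_measurable (borel :: heis measure)"
  shows "(\<integral>\<^sup>+w. f w \<partial>lborel) = (\<integral>\<^sup>+x. \<integral>\<^sup>+y. \<integral>\<^sup>+z. f (x, y, z) \<partial>lborel \<partial>lborel \<partial>lborel)"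
proof -
  have "f \<in> borel_measurable (lborel \<Otimes>\<^sub>M (lborel \<Otimes>\<^sub>M lborel))"
    using assms by (simp add: lborel_prod)
  then have "(\<integral>\<^sup>+w. f w \<partial>(lborel \<Otimes>\<^sub>M (lborel \<Otimes>\<^sub>M lborel)))
      = (\<integral>\<^sup>+x. \<integral>\<^sup>+yz. f (x, yz) \<partial>(lborel \<Otimes>\<^sub>M lborel) \<partial>lborel)"
    by (subst lborel_prod, subst lborel_prod, subst lborel.nn_integral_fst[symmetric])
       (simp_all add: lborel_prod)
  also have "\<dots> = (\<integral>\<^sup>+x. \<integral>\<^sup>+y. \<integral>\<^sup>+z. f (x, y, z) \<partial>lborel \<partial>lborel \<partial>lborel)"
  proof (intro nn_integral_cong)
    fix x :: real
    have "(\<lambda>yz. f (x, yz)) \<in> borel_measurable (lborel \<Otimes>\<^sub>M lborel)"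
      unfolding lborel_prod by measurable
    then show "(\<integral>\<^sup>+yz. f (x, yz) \<partial>(lborel \<Otimes>\<^sub>M lborel)) = (\<integral>\<^sup>+y. \<integral>\<^sup>+z. f (x, y, z) \<partial>lborel \<partial>lborel)"
      by (subst lborel.nn_integral_fst[symmetric]) simp_all
  qed
  finally show ?thesis
    by (simp add: lborel_prod)
qed

lemma measurable_heisI [measurable (raw)]:
  fixes f g h :: "'a \<Rightarrow> real"
  assumes [measurable]: "f \<in> borel_measurable M" "g \<in> borel_measurable M" "h \<in> borel_measurable M"
  shows "(\<lambda>w. (f w, g w, h w)) \<in> M \<rightarrow>\<^sub>M (borel :: heis measure)"
  by measurable

lemma nn_integral_real_isometry:
  fixes f :: "real \<Rightarrow> ennreal"
  assumes "f \<in> borel_measurable borel" "\<bar>s\<bar> = 1"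
  shows "(\<integral>\<^sup>+x. f (t + s * x) \<partial>lborel) = (\<integral>\<^sup>+x. f x \<partial>lborel)"
  using nn_integral_real_affine[of f s t] assms by auto

text \<open>Left translations and the reflections of the coordinates are both of this form.\<close>

definition heis_shear :: "real \<Rightarrow> real \<Rightarrow> real \<Rightarrow> real \<Rightarrow> real \<Rightarrow> (real \<Rightarrow> real \<Rightarrow> real) \<Rightarrow> heis \<Rightarrow> heis" where
  "heis_shear a s b t u g = (\<lambda>(x, y, z). (a + s * x, b + t * y, g x y + u * z))"

lemma measurable_heis_shear [measurable]:
  assumes [measurable]: "case_prod g \<in> borel_measurable borel"
  shows "heis_shear a s b t u g \<in> borel \<rightarrow>\<^sub>M borel"
proof -
  have "(\<lambda>w::heis. (fst w, fst (snd w))) \<in> borel \<rightarrow>\<^sub>M borel"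
    by (intro borel_measurable_continuous_onI continuous_intros)
  from measurable_compose[OF this assms]
  have g: "(\<lambda>w::heis. g (fst w) (fst (snd w))) \<in> borel_measurable borel"
    by simp
  have "fst \<in> borel_measurable (borel :: heis measure)"
    "(\<lambda>w::heis. fst (snd w)) \<in> borel_measurable borel"
    "(\<lambda>w::heis. snd (snd w)) \<in> borel_measurable borel"
    by (intro borel_measurable_continuous_onI continuous_intros)+
  with g show ?thesis
    unfolding heis_shear_def case_prod_beta
    by (intro measurable_heisI borel_measurable_add borel_measurable_times borel_measurable_const)
       (fact | assumption)+
qed

text \<open>For fixed \<open>x\<close> and \<open>y\<close> the term \<open>g x y\<close> is a mere
  constant, so integrating in \<open>z\<close> first removes it; translations and reflections in
  \<open>y\<close> and then \<open>x\<close> finish. No Jacobian is computed.\<close>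

lemma lborel_distr_heis_shear:
  assumes g [measurable]: "case_prod g \<in> borel_measurable borel"
    and "\<bar>s\<bar> = 1" "\<bar>t\<bar> = 1" "\<bar>u\<bar> = 1"
  shows "distr lborel borel (heis_shear a s b t u g) = lborel"
proof (rule measure_eqI)
  fix A :: "heis set" assume "A \<in> sets (distr lborel borel (heis_shear a s b t u g))"
  then have A [measurable]: "A \<in> sets borel" by simp
  note [measurable] = measurable_heis_shear[OF g]
  have meas_y: "(\<lambda>y. \<integral>\<^sup>+z. indicator A (x, y, z) \<partial>lborel) \<in> borel_measurable borel" for x :: real
    by measurable
  have meas_x: "(\<lambda>x. \<integral>\<^sup>+y. \<integral>\<^sup>+z. indicator A (x, y, z) \<partial>lborel \<partial>lborel) \<in> borel_measurable borel"
    by measurable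
  have "emeasure (distr lborel borel (heis_shear a s b t u g)) A
      = (\<integral>\<^sup>+w. indicator A (heis_shear a s b t u g w) \<partial>lborel)"
    using nn_integral_distr[of "heis_shear a s b t u g" lborel borel "indicator A"] by simp
  also have "\<dots> = (\<integral>\<^sup>+x. \<integral>\<^sup>+y. \<integral>\<^sup>+z. indicator A (a + s * x, b + t * y, g x y + u * z) \<partial>lborel \<partial>lborel \<partial>lborel)"
    by (subst nn_integral_heis) (measurable, simp add: heis_shear_def)
  also have "\<dots> = (\<integral>\<^sup>+x. \<integral>\<^sup>+y. \<integral>\<^sup>+z. indicator A (a + s * x, b + t * y, z) \<partial>lborel \<partial>lborel \<partial>lborel)"
    by (intro nn_integral_cong nn_integral_real_isometry assms) measurable
  also have "\<dots> = (\<integral>\<^sup>+x. \<integral>\<^sup>+y. \<integral>\<^sup>+z. indicator A (a + s * x, y, z) \<partial>lborel \<partial>lborel \<partial>lborel)"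
    by (intro nn_integral_cong nn_integral_real_isometry assms meas_y)
  also have "\<dots> = (\<integral>\<^sup>+x. \<integral>\<^sup>+y. \<integral>\<^sup>+z. indicator A (x, y, z) \<partial>lborel \<partial>lborel \<partial>lborel)"
    by (intro nn_integral_real_isometry assms meas_x)
  also have "\<dots> = emeasure lborel A"
    by (subst nn_integral_heis[symmetric]) simp_all
  finally show "emeasure (distr lborel borel (heis_shear a s b t u g)) A = emeasure lborel A" .
qed simp

lemma set_integral_heis_shear:
  fixes f :: "heis \<Rightarrow> real"
  assumes g [measurable]: "case_prod g \<in> borel_measurable borel"
    and "\<bar>s\<bar> = 1" "\<bar>t\<bar> = 1" "\<bar>u\<bar> = 1"
    and [measurable]: "f \<in> borel_measurable borel" "S \<in> sets borel"
  shows "(LINT w:S|lborel. f w)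
    = (LINT w:{w. heis_shear a s b t u g w \<in> S}|lborel. f (heis_shear a s b t u g w))"
proof -
  note [measurable] = measurable_heis_shear[OF g]
  have "(LINT w|lborel. indicator S w *\<^sub>R f w)
      = (LINT w|distr lborel borel (heis_shear a s b t u g). indicator S w *\<^sub>R f w)"
    by (simp add: lborel_distr_heis_shear assms)
  also have "\<dots> = (LINT w|lborel. indicator S (heis_shear a s b t u g w) *\<^sub>R f (heis_shear a s b t u g w))"
    by (rule integral_distr) measurable
  finally show ?thesis
    by (simp add: set_lebesgue_integral_def indicator_def)
qed

section \<open>Moments of the Koranyi ball\<close>

text \<open>Explicit antiderivatives \<open>?F\<close> and \<open>?G\<close>. The formulas serve
  twice: for the planar discs, and the first one again for the vertical integral giving the
  volume.\<close>

lemma has_integral_sqrt_disc: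
  fixes R :: real
  assumes "0 < R"
  shows "((\<lambda>x. sqrt (R\<^sup>2 - x\<^sup>2)) has_integral pi * R\<^sup>2 / 2) {-R..R}"
    and "((\<lambda>x. x\<^sup>2 * sqrt (R\<^sup>2 - x\<^sup>2)) has_integral pi * R ^ 4 / 8) {-R..R}"
proof -
  let ?F = "\<lambda>x. x * sqrt (R\<^sup>2 - x\<^sup>2) / 2 + R\<^sup>2 / 2 * arcsin (x / R)"
  let ?G = "\<lambda>x. x * (2 * x\<^sup>2 - R\<^sup>2) * sqrt (R\<^sup>2 - x\<^sup>2) / 8 + R ^ 4 / 8 * arcsin (x / R)"
  have d: "((\<lambda>x. sqrt (R\<^sup>2 - x\<^sup>2)) has_real_derivative - x / sqrt (R\<^sup>2 - x\<^sup>2)) (at x)"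
    "((\<lambda>x. arcsin (x / R)) has_real_derivative 1 / sqrt (R\<^sup>2 - x\<^sup>2)) (at x)"
    "0 < R\<^sup>2 - x\<^sup>2"
    if "x \<in> {-R<..<R}" for x
  proof -
    show pos: "0 < R\<^sup>2 - x\<^sup>2"
      using that abs_square_less_1[of "x / R"] assms by (auto simp: power_divide divide_simps abs_if split: if_splits)
    show "((\<lambda>x. sqrt (R\<^sup>2 - x\<^sup>2)) has_real_derivative - x / sqrt (R\<^sup>2 - x\<^sup>2)) (at x)"
      using pos by (auto intro!: derivative_eq_intros simp: field_simps)
    have s: "sqrt (1 - (x / R)\<^sup>2) = sqrt (R\<^sup>2 - x\<^sup>2) / R"
    proof -
      have "1 - (x / R)\<^sup>2 = (R\<^sup>2 - x\<^sup>2) / R\<^sup>2"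
        using assms by (simp add: field_simps)
      then show ?thesis
        using assms by (simp add: real_sqrt_divide)
    qed
    have "((\<lambda>x. arcsin (x / R)) has_real_derivative inverse (sqrt (1 - (x / R)\<^sup>2)) * (1 / R)) (at x)"
      using that assms by (intro DERIV_chain2[OF DERIV_arcsin]) (auto intro!: derivative_eq_intros simp: field_simps)
    then show "((\<lambda>x. arcsin (x / R)) has_real_derivative 1 / sqrt (R\<^sup>2 - x\<^sup>2)) (at x)"
      using assms unfolding s by (simp add: field_simps)
  qed
  have "((\<lambda>x. sqrt (R\<^sup>2 - x\<^sup>2)) has_integral ?F R - ?F (-R)) {-R..R}"
  \<comment> \<open>Only continuity is available at the endpoints, where \<open>sqrt\<close> and
    \<open>arcsin\<close> have infinite slope.\<close>
  proof (rule fundamental_theorem_of_calculus_interior)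
    show "continuous_on {-R..R} ?F" using assms by (auto intro!: continuous_intros simp: field_simps)
    fix x assume x: "x \<in> {-R<..<R}"
    define q where "q = sqrt (R\<^sup>2 - x\<^sup>2)"
    have q: "q > 0" "q\<^sup>2 = R\<^sup>2 - x\<^sup>2" using d(3)[OF x] by (auto simp: q_def)
    have *: "(1 * q + - x / q * x) / 2 + R\<^sup>2 / 2 * (1 / q) = q"
      using q by (simp add: field_simps power2_eq_square)
    show "(?F has_vector_derivative sqrt (R\<^sup>2 - x\<^sup>2)) (at x)"
      unfolding has_real_derivative_iff_has_vector_derivative[symmetric]
      using DERIV_add[OF DERIV_cdivide[OF DERIV_mult[OF DERIV_ident d(1)[OF x]], of 2]
          DERIV_cmult[OF d(2)[OF x], of "R\<^sup>2 / 2"]] *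
      by (simp add: q_def)
  qed (use assms in auto)
  then show "((\<lambda>x. sqrt (R\<^sup>2 - x\<^sup>2)) has_integral pi * R\<^sup>2 / 2) {-R..R}"
    using assms by (simp add: arcsin_minus field_simps)
  have "((\<lambda>x. x\<^sup>2 * sqrt (R\<^sup>2 - x\<^sup>2)) has_integral ?G R - ?G (-R)) {-R..R}"
  proof (rule fundamental_theorem_of_calculus_interior)
    show "continuous_on {-R..R} ?G" using assms by (auto intro!: continuous_intros simp: field_simps)
    fix x assume x: "x \<in> {-R<..<R}"
    define q where "q = sqrt (R\<^sup>2 - x\<^sup>2)"
    have q: "q > 0" "q\<^sup>2 = R\<^sup>2 - x\<^sup>2" using d(3)[OF x] by (auto simp: q_def)
    \<comment> \<open>Eliminating \<open>R\<close> in favour of \<open>q\<close> and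
      \<open>x\<close> turns the derivative identity into a polynomial one.\<close>
    have R4: "R ^ 4 = (q\<^sup>2 + x\<^sup>2)\<^sup>2" "R\<^sup>2 = q\<^sup>2 + x\<^sup>2" by (simp_all add: q flip: power_mult)
    have *: "((6 * x\<^sup>2 - R\<^sup>2) * q + - x / q * (x * (2 * x\<^sup>2 - R\<^sup>2))) / 8 + R ^ 4 / 8 * (1 / q) = x\<^sup>2 * q"
      using q(1) unfolding R4 by (simp add: field_simps) algebra
    have p: "((\<lambda>x. x * (2 * x\<^sup>2 - R\<^sup>2)) has_real_derivative 6 * x\<^sup>2 - R\<^sup>2) (at x)"
      by (auto intro!: derivative_eq_intros simp: power2_eq_square)
    show "(?G has_vector_derivative x\<^sup>2 * sqrt (R\<^sup>2 - x\<^sup>2)) (at x)"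
      unfolding has_real_derivative_iff_has_vector_derivative[symmetric]
      using DERIV_add[OF DERIV_cdivide[OF DERIV_mult[OF p d(1)[OF x]], of 8]
          DERIV_cmult[OF d(2)[OF x], of "R ^ 4 / 8"]] *
      by (simp add: q_def)
  qed (use assms in auto)
  then show "((\<lambda>x. x\<^sup>2 * sqrt (R\<^sup>2 - x\<^sup>2)) has_integral pi * R ^ 4 / 8) {-R..R}"
    using assms by (simp add: arcsin_minus field_simps)
qed

section \<open>Koranyi balls: left invariance, boundedness and sign symmetries\<close>

lemma mem_heis_ball_0:
  assumes "0 < r"
  shows "(x, y, z) \<in> heis_ball r (0, 0, 0) \<longleftrightarrow> (x\<^sup>2 + y\<^sup>2)\<^sup>2 + 16 * z\<^sup>2 < r ^ 4"
proof -
  have "root 4 ((x\<^sup>2 + y\<^sup>2)\<^sup>2 + 16 * z\<^sup>2) < root 4 (r ^ 4) \<longleftrightarrow> (x\<^sup>2 + y\<^sup>2)\<^sup>2 + 16 * z\<^sup>2 < r ^ 4"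
    by (rule real_root_less_iff) simp
  then show ?thesis
    using assms by (simp add: heis_ball_def heis_dist_def real_root_power_cancel)
qed

lemma heis_mult_mem_ball_iff [simp]: "q \<odot> w \<in> heis_ball r q \<longleftrightarrow> w \<in> heis_ball r (0, 0, 0)"
  by (simp add: heis_ball_def heis_dist_def heis_inverse heis_unit flip: heis_assoc)

lemma heis_ball_eq_image: "heis_ball r q = (\<lambda>w. q \<odot> w) ` heis_ball r (0, 0, 0)"
proof (intro set_eqI iffI)
  fix p assume "p \<in> heis_ball r q"
  moreover have "p = q \<odot> (heis_inv q \<odot> p)"
    by (simp add: heis_inverse heis_unit flip: heis_assoc)
  ultimately show "p \<in> (\<lambda>w. q \<odot> w) ` heis_ball r (0, 0, 0)"
    by (metis heis_mult_mem_ball_iff image_eqI)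
qed auto

lemma heis_mult_eq_shear:
  "(\<lambda>w. (a, b, c) \<odot> w) = heis_shear a 1 b 1 1 (\<lambda>x y. c + (a * y - b * x) / 2)"
  by (auto simp: heis_shear_def fun_eq_iff)

lemma continuous_on_heis_mult [continuous_intros]:
  fixes f g :: "'a::topological_space \<Rightarrow> heis"
  assumes "continuous_on S f" "continuous_on S g"
  shows "continuous_on S (\<lambda>w. f w \<odot> g w)"
proof -
  have *: "p \<odot> p' = (fst p + fst p', fst (snd p) + fst (snd p'),
      snd (snd p) + snd (snd p') + (fst p * fst (snd p') - fst (snd p) * fst p') / 2)" for p p'
    by (cases p; cases p') simp
  show ?thesis
    unfolding * by (intro continuous_intros assms) auto
qed

lemma continuous_on_koranyi: "continuous_on UNIV koranyi"
proof -
  have *: "koranyi = (\<lambda>p. root 4 (((fst p)\<^sup>2 + (fst (snd p))\<^sup>2)\<^sup>2 + 16 * (snd (snd p))\<^sup>2))"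
    by (auto simp: fun_eq_iff)
  show ?thesis
    unfolding * by (intro continuous_intros)
qed

lemma open_heis_ball: "open (heis_ball r q)"
proof -
  have "continuous_on UNIV (\<lambda>w. koranyi (heis_inv q \<odot> w))"
    by (rule continuous_on_compose2[OF continuous_on_koranyi]) (auto intro!: continuous_intros)
  then show ?thesis
    unfolding heis_ball_def heis_dist_def by (intro open_Collect_less) auto
qed

lemma heis_ball_measurable [measurable]: "heis_ball r q \<in> sets borel"
  by (rule borel_open[OF open_heis_ball])

lemma heis_ball_0_bounds:
  assumes "0 < r" "(x, y, z) \<in> heis_ball r (0, 0, 0)"
  shows "x\<^sup>2 + y\<^sup>2 < r\<^sup>2" "\<bar>x\<bar> < r" "\<bar>y\<bar> < r" "\<bar>z\<bar> < r\<^sup>2 / 4"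
proof -
  have *: "(x\<^sup>2 + y\<^sup>2)\<^sup>2 + 16 * z\<^sup>2 < (r\<^sup>2)\<^sup>2"
    using assms by (simp add: mem_heis_ball_0 flip: power_mult)
  have "(x\<^sup>2 + y\<^sup>2)\<^sup>2 < (r\<^sup>2)\<^sup>2"
    using * zero_le_power2[of z] by linarith
  then show xy: "x\<^sup>2 + y\<^sup>2 < r\<^sup>2"
    by (rule power2_less_imp_less) simp
  have "\<bar>x\<bar>\<^sup>2 < r\<^sup>2" "\<bar>y\<bar>\<^sup>2 < r\<^sup>2"
    using xy zero_le_power2[of x] zero_le_power2[of y] by (simp_all only: power2_abs)
  then show "\<bar>x\<bar> < r" "\<bar>y\<bar> < r"
    using assms(1) by (auto intro: power2_less_imp_less)
  have "16 * z\<^sup>2 < (r\<^sup>2)\<^sup>2"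
    using * zero_le_power2[of "x\<^sup>2 + y\<^sup>2"] by linarith
  then have "(4 * \<bar>z\<bar>)\<^sup>2 < (r\<^sup>2)\<^sup>2"
    by (simp add: power_mult_distrib)
  then have "4 * \<bar>z\<bar> < r\<^sup>2"
    by (rule power2_less_imp_less) simp
  then show "\<bar>z\<bar> < r\<^sup>2 / 4" by simp
qed

lemma heis_ball_subset_compact:
  assumes "0 < r"
  obtains K where "compact K" "heis_ball r q \<subseteq> K"
proof
  show "compact ((\<lambda>w. q \<odot> w) ` ({-r..r} \<times> {-r..r} \<times> {-r\<^sup>2..r\<^sup>2}))"
    by (intro compact_continuous_image continuous_intros compact_Times compact_Icc)
  have "heis_ball r (0, 0, 0) \<subseteq> {-r..r} \<times> {-r..r} \<times> {-r\<^sup>2..r\<^sup>2}"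
  proof
    fix w assume "w \<in> heis_ball r (0, 0, 0)"
    then show "w \<in> {-r..r} \<times> {-r..r} \<times> {-r\<^sup>2..r\<^sup>2}"
      using heis_ball_0_bounds[OF assms, of "fst w" "fst (snd w)" "snd (snd w)"] assms
      by (cases w) (auto simp: abs_le_iff abs_less_iff)
  qed
  then show "heis_ball r q \<subseteq> (\<lambda>w. q \<odot> w) ` ({-r..r} \<times> {-r..r} \<times> {-r\<^sup>2..r\<^sup>2})"
    unfolding heis_ball_eq_image[of r q] by blast
qed

lemma set_integrable_heis_ball:
  fixes f :: "heis \<Rightarrow> real"
  assumes "0 < r" "continuous_on UNIV f"
  shows "set_integrable lborel (heis_ball r q) f"
proof -
  obtain K where "compact K" "heis_ball r q \<subseteq> K"
    using heis_ball_subset_compact[OF assms(1)] .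
  then have "set_integrable lborel K f"
    unfolding set_integrable_def
    by (intro borel_integrable_compact continuous_on_subset[OF assms(2)]) auto
  then show ?thesis
    by (rule set_integrable_subset) (use \<open>heis_ball r q \<subseteq> K\<close> in auto)
qed

lemma set_integral_heis_ball_translate:
  fixes f :: "heis \<Rightarrow> real"
  assumes [measurable]: "f \<in> borel_measurable borel"
  shows "(LINT w:heis_ball r q|lborel. f w) = (LINT w:heis_ball r (0, 0, 0)|lborel. f (q \<odot> w))"
proof -
  obtain a b c where q: "q = (a, b, c)" by (cases q)
  have "{w. q \<odot> w \<in> heis_ball r q} = heis_ball r (0, 0, 0)" by simp
  moreover have "(LINT w:heis_ball r q|lborel. f w) = (LINT w:{w. q \<odot> w \<in> heis_ball r q}|lborel. f (q \<odot> w))"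
    unfolding q heis_mult_eq_shear[of a b c, unfolded fun_eq_iff, rule_format]
    by (rule set_integral_heis_shear) (auto simp: case_prod_beta intro!: borel_measurable_continuous_onI continuous_intros)
  ultimately show ?thesis by simp
qed

text \<open>The gauge sees the coordinates only through their squares, so each sign change preserves
  both the ball and Lebesgue measure; the integral therefore equals its own negative.\<close>

lemma set_integral_heis_ball_odd:
  fixes f :: "heis \<Rightarrow> real"
  assumes "0 < r" and [measurable]: "f \<in> borel_measurable borel"
    and "\<bar>s\<bar> = 1" "\<bar>t\<bar> = 1" "\<bar>u\<bar> = 1"
    and odd: "\<And>x y z. f (s * x, t * y, u * z) = - f (x, y, z)"
  shows "(LINT w:heis_ball r (0, 0, 0)|lborel. f w) = 0"
proof -
  have [simp]: "s\<^sup>2 = 1" "t\<^sup>2 = 1" "u\<^sup>2 = 1"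
    using assms(3-5) by (metis power2_abs one_power2)+
  have "{w. heis_shear 0 s 0 t u (\<lambda>_ _. 0) w \<in> heis_ball r (0, 0, 0)} = heis_ball r (0, 0, 0)"
    by (auto simp: heis_shear_def mem_heis_ball_0[OF \<open>0 < r\<close>] power_mult_distrib)
  then have "(LINT w:heis_ball r (0, 0, 0)|lborel. f w)
      = (LINT w:heis_ball r (0, 0, 0)|lborel. f (heis_shear 0 s 0 t u (\<lambda>_ _. 0) w))"
    using set_integral_heis_shear[of "\<lambda>_ _. 0" s t u f "heis_ball r (0, 0, 0)" 0 0] assms by simp
  also have "\<dots> = (LINT w:heis_ball r (0, 0, 0)|lborel. - f w)"
    by (intro set_lebesgue_integral_cong) (auto simp: heis_shear_def odd)
  also have "\<dots> = - (LINT w:heis_ball r (0, 0, 0)|lborel. f w)"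
    by (simp add: set_lebesgue_integral_def)
  finally show ?thesis by simp
qed

section \<open>Volume and horizontal second moments by horizontal slices\<close>

lemma nn_integral_Icc:
  fixes g :: "real \<Rightarrow> real"
  assumes "f \<in> borel_measurable borel" "(g has_integral I) {a..b}"
    and "\<And>x. x \<in> {a..b} \<Longrightarrow> f x = ennreal (g x) \<and> 0 \<le> g x"
    and "\<And>x. x \<notin> {a..b} \<Longrightarrow> f x = 0"
    and "g \<in> borel_measurable borel"
  shows "(\<integral>\<^sup>+x. f x \<partial>lborel) = ennreal I"
proof -
  have "(\<integral>\<^sup>+x. f x \<partial>lborel) = (\<integral>\<^sup>+x. ennreal (if x \<in> {a..b} then g x else 0) \<partial>lborel)"
    by (intro nn_integral_cong) (simp add: assms(3,4))
  also have "\<dots> = ennreal I"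
  proof (rule nn_integral_has_integral_lborel)
    show "(\<lambda>x. if x \<in> {a..b} then g x else 0) \<in> borel_measurable borel"
      using assms(5) by measurable
    show "((\<lambda>x. if x \<in> {a..b} then g x else 0) has_integral I) UNIV"
      using assms(2) unfolding has_integral_restrict_UNIV .
  qed (simp add: assms(3))
  finally show ?thesis .
qed

text \<open>Valid without any sign condition on \<open>D - x\<^sup>2\<close>: \<open>sqrt\<close> is
  odd and increasing on all reals, so an empty section gives a nonpositive root, which
  \<open>ennreal\<close> sends to 0.\<close>

lemma nn_integral_section:
  fixes D x :: real
  shows "(\<integral>\<^sup>+y. indicator {y. x\<^sup>2 + y\<^sup>2 < D} y \<partial>lborel) = ennreal (2 * sqrt (D - x\<^sup>2))"
proof -
  define s where "s = sqrt (D - x\<^sup>2)"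
  have "x\<^sup>2 + y\<^sup>2 < D \<longleftrightarrow> \<bar>y\<bar> < s" for y
  proof -
    have "\<bar>y\<bar> < s \<longleftrightarrow> y\<^sup>2 < D - x\<^sup>2"
      unfolding s_def real_sqrt_abs[symmetric] by (rule real_sqrt_less_iff)
    then show ?thesis by (simp add: less_diff_eq add.commute)
  qed
  moreover have "\<bar>y\<bar> < s \<longleftrightarrow> - s < y \<and> y < s" for y
    by arith
  ultimately have "{y. x\<^sup>2 + y\<^sup>2 < D} = {- s <..< s}"
    unfolding set_eq_iff mem_Collect_eq greaterThanLessThan_iff by simp
  then have "(\<integral>\<^sup>+y. indicator {y. x\<^sup>2 + y\<^sup>2 < D} y \<partial>lborel) = emeasure lborel {- s <..< s}"
    by (simp only:) (rule nn_integral_indicator, simp)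
  also have "\<dots> = ennreal (2 * s)"
    by (cases "0 \<le> s") (simp_all add: ennreal_neg)
  finally show ?thesis unfolding s_def .
qed

lemma square_diff_sign:
  fixes R x :: real
  assumes "0 < R"
  shows "x \<notin> {-R..R} \<Longrightarrow> R\<^sup>2 - x\<^sup>2 \<le> 0" "x \<in> {-R..R} \<Longrightarrow> 0 \<le> R\<^sup>2 - x\<^sup>2"
  using abs_le_square_iff[of R x] abs_le_square_iff[of x R] assms
  by (simp_all only: atLeastAtMost_iff) linarith+

text \<open>\<open>D\<close> is the squared radius of the disc, the quantity that the gauge
  condition provides at a given height.\<close>

lemma nn_integral_disc:
  fixes D :: real
  assumes "0 < D"
  shows "(\<integral>\<^sup>+x. \<integral>\<^sup>+y. indicator {y. x\<^sup>2 + y\<^sup>2 < D} y \<partial>lborel \<partial>lborel) = ennreal (pi * D)"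
    and "(\<integral>\<^sup>+x. \<integral>\<^sup>+y. ennreal (x\<^sup>2) * indicator {y. x\<^sup>2 + y\<^sup>2 < D} y \<partial>lborel \<partial>lborel) = ennreal (pi * D\<^sup>2 / 4)"
proof -
  define R where "R = sqrt D"
  have R: "0 < R" "D = R\<^sup>2" using assms by (auto simp: R_def)
  note out = square_diff_sign(1)[OF R(1)] and inn = square_diff_sign(2)[OF R(1)]
  have "(\<integral>\<^sup>+x. ennreal (2 * sqrt (R\<^sup>2 - x\<^sup>2)) \<partial>lborel) = ennreal (2 * (pi * R\<^sup>2 / 2))"
  proof (rule nn_integral_Icc[OF _ has_integral_mult_right[OF has_integral_sqrt_disc(1)[OF R(1)]]])
    show "ennreal (2 * sqrt (R\<^sup>2 - x\<^sup>2)) = ennreal (2 * sqrt (R\<^sup>2 - x\<^sup>2)) \<and> 0 \<le> 2 * sqrt (R\<^sup>2 - x\<^sup>2)"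
      if "x \<in> {-R..R}" for x
      using inn[OF that] by simp
    show "ennreal (2 * sqrt (R\<^sup>2 - x\<^sup>2)) = 0" if "x \<notin> {-R..R}" for x
      using out[OF that] by (simp add: ennreal_neg)
  qed measurable
  then show "(\<integral>\<^sup>+x. \<integral>\<^sup>+y. indicator {y. x\<^sup>2 + y\<^sup>2 < D} y \<partial>lborel \<partial>lborel) = ennreal (pi * D)"
    unfolding nn_integral_section by (simp add: R(2))
  have mult: "ennreal (x\<^sup>2) * ennreal (2 * c) = ennreal (2 * (x\<^sup>2 * c))" for x c :: real
    by (subst ennreal_mult'[symmetric]) (simp_all add: ac_simps)
  have "(\<integral>\<^sup>+x. ennreal (x\<^sup>2) * ennreal (2 * sqrt (R\<^sup>2 - x\<^sup>2)) \<partial>lborel) = ennreal (2 * (pi * R ^ 4 / 8))"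
    unfolding mult
  proof (rule nn_integral_Icc[OF _ has_integral_mult_right[OF has_integral_sqrt_disc(2)[OF R(1)]]])
    show "ennreal (2 * (x\<^sup>2 * sqrt (R\<^sup>2 - x\<^sup>2))) = ennreal (2 * (x\<^sup>2 * sqrt (R\<^sup>2 - x\<^sup>2)))
        \<and> 0 \<le> 2 * (x\<^sup>2 * sqrt (R\<^sup>2 - x\<^sup>2))" if "x \<in> {-R..R}" for x
      using inn[OF that] by simp
    show "ennreal (2 * (x\<^sup>2 * sqrt (R\<^sup>2 - x\<^sup>2))) = 0" if "x \<notin> {-R..R}" for x
      using out[OF that] by (simp add: ennreal_neg mult_nonneg_nonpos)
  qed measurable
  moreover have "(\<integral>\<^sup>+y. ennreal (x\<^sup>2) * indicator {y. x\<^sup>2 + y\<^sup>2 < D} y \<partial>lborel)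
      = ennreal (x\<^sup>2) * ennreal (2 * sqrt (D - x\<^sup>2))" for x
    by (subst nn_integral_cmult) (simp_all add: nn_integral_section)
  ultimately show "(\<integral>\<^sup>+x. \<integral>\<^sup>+y. ennreal (x\<^sup>2) * indicator {y. x\<^sup>2 + y\<^sup>2 < D} y \<partial>lborel \<partial>lborel) = ennreal (pi * D\<^sup>2 / 4)"
    by (simp add: R(2) flip: power_mult)
qed


text \<open>Two applications of Tonelli move \<open>z\<close> outermost, because at fixed height the
  Koranyi ball is a Euclidean disc of squared radius
  \<open>sqrt (r ^ 4 - 16 * z\<^sup>2)\<close>.\<close>

lemma nn_integral_heis_ball_slices:
  fixes f :: "real \<Rightarrow> real \<Rightarrow> ennreal"
  assumes "0 < r" and [measurable]: "case_prod f \<in> borel_measurable borel"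
  shows "(\<integral>\<^sup>+w. f (fst w) (fst (snd w)) * indicator (heis_ball r (0, 0, 0)) w \<partial>lborel)
    = (\<integral>\<^sup>+z. \<integral>\<^sup>+x. \<integral>\<^sup>+y. f x y * indicator {y. x\<^sup>2 + y\<^sup>2 < sqrt (r ^ 4 - 16 * z\<^sup>2)} y \<partial>lborel \<partial>lborel \<partial>lborel)"
proof -
  let ?B = "heis_ball r (0, 0, 0)"
  have "(\<lambda>w::heis. (fst w, fst (snd w))) \<in> borel \<rightarrow>\<^sub>M borel"
    by (intro borel_measurable_continuous_onI continuous_intros)
  from measurable_compose[OF this assms(2)]
  have [measurable]: "(\<lambda>w::heis. f (fst w) (fst (snd w))) \<in> borel_measurable borel"
    by simp
  define F where "F = (\<lambda>w::heis. f (fst w) (fst (snd w)) * indicator ?B w)"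
  have F [measurable]: "F \<in> borel_measurable borel"
    unfolding F_def by measurable
  have "(\<integral>\<^sup>+w. F w \<partial>lborel) = (\<integral>\<^sup>+x. \<integral>\<^sup>+y. \<integral>\<^sup>+z. F (x, y, z) \<partial>lborel \<partial>lborel \<partial>lborel)"
    by (rule nn_integral_heis[OF F])
  also have "\<dots> = (\<integral>\<^sup>+x. \<integral>\<^sup>+z. \<integral>\<^sup>+y. F (x, y, z) \<partial>lborel \<partial>lborel \<partial>lborel)"
  proof (rule nn_integral_cong)
    fix x :: real
    show "(\<integral>\<^sup>+y. \<integral>\<^sup>+z. F (x, y, z) \<partial>lborel \<partial>lborel) = (\<integral>\<^sup>+z. \<integral>\<^sup>+y. F (x, y, z) \<partial>lborel \<partial>lborel)"
      by (rule lborel_pair.Fubini'[symmetric]) measurable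
  qed
  also have "\<dots> = (\<integral>\<^sup>+z. \<integral>\<^sup>+x. \<integral>\<^sup>+y. F (x, y, z) \<partial>lborel \<partial>lborel \<partial>lborel)"
    by (rule lborel_pair.Fubini'[symmetric]) measurable
  also have "\<dots> = (\<integral>\<^sup>+z. \<integral>\<^sup>+x. \<integral>\<^sup>+y. f x y * indicator {y. x\<^sup>2 + y\<^sup>2 < sqrt (r ^ 4 - 16 * z\<^sup>2)} y \<partial>lborel \<partial>lborel \<partial>lborel)"
  proof (intro nn_integral_cong)
    fix z x y :: real
    \<comment> \<open>Monotonicity of \<open>sqrt\<close> on all reals also covers heights above the
      ball: the right side is then negative and the slice empty.\<close>
    have "(x\<^sup>2 + y\<^sup>2)\<^sup>2 + 16 * z\<^sup>2 < r ^ 4 \<longleftrightarrow> sqrt ((x\<^sup>2 + y\<^sup>2)\<^sup>2) < sqrt (r ^ 4 - 16 * z\<^sup>2)"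
      unfolding real_sqrt_less_iff by linarith
    then have "(x, y, z) \<in> ?B \<longleftrightarrow> x\<^sup>2 + y\<^sup>2 < sqrt (r ^ 4 - 16 * z\<^sup>2)"
      by (simp add: mem_heis_ball_0[OF assms(1)])
    then show "F (x, y, z) = f x y * indicator {y. x\<^sup>2 + y\<^sup>2 < sqrt (r ^ 4 - 16 * z\<^sup>2)} y"
      by (simp add: F_def indicator_def)
  qed
  finally show ?thesis unfolding F_def .
qed

text \<open>As a function of \<open>z\<close> the squared slice radius is four times a half circle
  of radius \<open>r\<^sup>2 / 4\<close>, which brings \<open>has_integral_sqrt_disc\<close> back
  into play.\<close>

lemma heis_ball_slice_sqrt:
  fixes r z :: real
  shows "sqrt (r ^ 4 - 16 * z\<^sup>2) = 4 * sqrt ((r\<^sup>2 / 4)\<^sup>2 - z\<^sup>2)"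
proof -
  have "r ^ 4 - 16 * z\<^sup>2 = 4\<^sup>2 * ((r\<^sup>2 / 4)\<^sup>2 - z\<^sup>2)"
    by (simp add: power_divide right_diff_distrib flip: power_mult)
  then show ?thesis
    by (simp only: real_sqrt_mult real_sqrt_abs abs_numeral)
qed

lemma emeasure_heis_ball_0:
  assumes "0 < r"
  shows "emeasure lborel (heis_ball r (0, 0, 0)) = ennreal (pi\<^sup>2 * r ^ 4 / 8)"
proof -
  let ?R = "r\<^sup>2 / 4"
  have R: "0 < ?R" using assms by simp
  note out = square_diff_sign(1)[OF R] and inn = square_diff_sign(2)[OF R]
  have slice: "(\<integral>\<^sup>+x. \<integral>\<^sup>+y. indicator {y. x\<^sup>2 + y\<^sup>2 < D} y \<partial>lborel \<partial>lborel) = ennreal (pi * D)" for D :: real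
  proof (cases "0 < D")
    case False
    then have "\<not> x\<^sup>2 + y\<^sup>2 < D" for x y
      using sum_power2_ge_zero[of x y] by linarith
    then have "{y. x\<^sup>2 + y\<^sup>2 < D} = {}" for x
      by simp
    then show ?thesis using False by (simp add: ennreal_neg mult_nonneg_nonpos)
  qed (rule nn_integral_disc)
  have "emeasure lborel (heis_ball r (0, 0, 0)) = (\<integral>\<^sup>+w. 1 * indicator (heis_ball r (0, 0, 0)) w \<partial>lborel)"
    by simp
  also have "\<dots> = (\<integral>\<^sup>+z. ennreal (pi * sqrt (r ^ 4 - 16 * z\<^sup>2)) \<partial>lborel)"
    using nn_integral_heis_ball_slices[OF assms, of "\<lambda>_ _. 1"] by (simp add: slice del: nn_integral_indicator)
  also have "\<dots> = ennreal ((pi * 4) * (pi * ?R\<^sup>2 / 2))"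
    unfolding heis_ball_slice_sqrt
  proof (rule nn_integral_Icc[OF _ has_integral_mult_right[OF has_integral_sqrt_disc(1)[OF R]]])
    show "ennreal (pi * (4 * sqrt (?R\<^sup>2 - x\<^sup>2))) = ennreal (pi * 4 * sqrt (?R\<^sup>2 - x\<^sup>2))
        \<and> 0 \<le> pi * 4 * sqrt (?R\<^sup>2 - x\<^sup>2)" if "x \<in> {-?R..?R}" for x
      using inn[OF that] by (simp add: mult.assoc)
    show "ennreal (pi * (4 * sqrt (?R\<^sup>2 - x\<^sup>2))) = 0" if "x \<notin> {-?R..?R}" for x
      using out[OF that] by (simp add: ennreal_neg mult_nonneg_nonpos)
  qed measurable
  also have "(pi * 4) * (pi * ?R\<^sup>2 / 2) = pi\<^sup>2 * r ^ 4 / 8"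
    by (simp add: power_divide power2_eq_square flip: power_mult) (simp add: power4_eq_xxxx)
  finally show ?thesis .
qed

text \<open>The second moment of a disc is quadratic in its squared radius, so the root disappears
  and the remaining integrand \<open>pi / 4 * (r ^ 4 - 16 * z\<^sup>2)\<close> is a polynomial.
  Hence a single \<open>pi\<close> here against \<open>pi\<^sup>2\<close> in the volume.\<close>

lemma nn_integral_heis_ball_squares:
  assumes "0 < r"
  shows "(\<integral>\<^sup>+w. ennreal ((fst w)\<^sup>2) * indicator (heis_ball r (0, 0, 0)) w \<partial>lborel) = ennreal (pi * r ^ 6 / 12)"
    and "(\<integral>\<^sup>+w. ennreal ((fst (snd w))\<^sup>2) * indicator (heis_ball r (0, 0, 0)) w \<partial>lborel) = ennreal (pi * r ^ 6 / 12)"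
proof -
  let ?R = "r\<^sup>2 / 4"
  have R: "0 < ?R" using assms by simp
  have eq: "r ^ 4 - 16 * x\<^sup>2 = 16 * (?R\<^sup>2 - x\<^sup>2)" for x
    by (simp add: power_divide right_diff_distrib flip: power_mult)
  have out: "r ^ 4 - 16 * x\<^sup>2 \<le> 0" if "x \<notin> {-?R..?R}" for x
    using square_diff_sign(1)[OF R that] unfolding eq by simp
  have inn: "0 \<le> r ^ 4 - 16 * x\<^sup>2" if "x \<in> {-?R..?R}" for x
    using square_diff_sign(2)[OF R that] unfolding eq by simp
  \<comment> \<open>The truncation \<open>max 0 D\<close> matters: outside the ball \<open>D\<close>
    is a negative root, and its square would be counted as positive.\<close>
  have slice: "(\<integral>\<^sup>+x. \<integral>\<^sup>+y. ennreal (x\<^sup>2) * indicator {y. x\<^sup>2 + y\<^sup>2 < D} y \<partial>lborel \<partial>lborel)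
      = ennreal (pi * (max 0 D)\<^sup>2 / 4)" for D :: real
  proof (cases "0 < D")
    case False
    then have "\<not> x\<^sup>2 + y\<^sup>2 < D" for x y
      using sum_power2_ge_zero[of x y] by linarith
    then have "{y. x\<^sup>2 + y\<^sup>2 < D} = {}" for x
      by simp
    then show ?thesis using False by (simp add: ennreal_neg mult_nonneg_nonpos)
  qed (simp add: nn_integral_disc(2))
  have "((\<lambda>z. pi / 4 * (r ^ 4 - 16 * z\<^sup>2)) has_integral
      pi / 4 * (r ^ 4 * ?R - 16 * ?R ^ 3 / 3) - pi / 4 * (r ^ 4 * (-?R) - 16 * (-?R) ^ 3 / 3)) {-?R..?R}"
    using R
    by (intro fundamental_theorem_of_calculus)
       (auto simp: power2_eq_square has_real_derivative_iff_has_vector_derivative[symmetric] intro!: derivative_eq_intros)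
  moreover have "pi / 4 * (r ^ 4 * ?R - 16 * ?R ^ 3 / 3) - pi / 4 * (r ^ 4 * (-?R) - 16 * (-?R) ^ 3 / 3) = pi * r ^ 6 / 12"
    by (simp add: field_simps eval_nat_numeral)
  ultimately have I: "((\<lambda>z. pi / 4 * (r ^ 4 - 16 * z\<^sup>2)) has_integral pi * r ^ 6 / 12) {-?R..?R}"
    by (simp only:)
  have z: "(\<integral>\<^sup>+z. ennreal (pi * (max 0 (sqrt (r ^ 4 - 16 * z\<^sup>2)))\<^sup>2 / 4) \<partial>lborel) = ennreal (pi * r ^ 6 / 12)"
  proof (rule nn_integral_Icc[OF _ I])
    show "ennreal (pi * (max 0 (sqrt (r ^ 4 - 16 * x\<^sup>2)))\<^sup>2 / 4) = ennreal (pi / 4 * (r ^ 4 - 16 * x\<^sup>2))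
        \<and> 0 \<le> pi / 4 * (r ^ 4 - 16 * x\<^sup>2)" if "x \<in> {-?R..?R}" for x
      using inn[OF that] by simp
    show "ennreal (pi * (max 0 (sqrt (r ^ 4 - 16 * x\<^sup>2)))\<^sup>2 / 4) = 0" if "x \<notin> {-?R..?R}" for x
      using out[OF that] by simp
  qed measurable
  have meas: "(\<lambda>(x, _). ennreal (x\<^sup>2)) \<in> borel_measurable (borel :: (real \<times> real) measure)"
    "(\<lambda>(_, y). ennreal (y\<^sup>2)) \<in> borel_measurable (borel :: (real \<times> real) measure)"
    unfolding case_prod_beta
    by (intro measurable_compose[OF _ measurable_ennreal] borel_measurable_continuous_onI continuous_intros)+
  show "(\<integral>\<^sup>+w. ennreal ((fst w)\<^sup>2) * indicator (heis_ball r (0, 0, 0)) w \<partial>lborel) = ennreal (pi * r ^ 6 / 12)"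
    using nn_integral_heis_ball_slices[OF assms meas(1)] by (simp add: slice z)
  \<comment> \<open>The disc is symmetric under exchanging \<open>x\<close> and \<open>y\<close>, so
    Tonelli reduces this moment to the previous one.\<close>
  have "(\<integral>\<^sup>+x. \<integral>\<^sup>+y. ennreal (y\<^sup>2) * indicator {y. x\<^sup>2 + y\<^sup>2 < D} y \<partial>lborel \<partial>lborel)
      = (\<integral>\<^sup>+y. \<integral>\<^sup>+x. ennreal (y\<^sup>2) * indicator {y. x\<^sup>2 + y\<^sup>2 < D} y \<partial>lborel \<partial>lborel)" for D :: real
    by (rule lborel_pair.Fubini'[symmetric]) measurable
  moreover have "(\<integral>\<^sup>+y. \<integral>\<^sup>+x. ennreal (y\<^sup>2) * indicator {y. x\<^sup>2 + y\<^sup>2 < D} y \<partial>lborel \<partial>lborel)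
      = (\<integral>\<^sup>+x. \<integral>\<^sup>+y. ennreal (x\<^sup>2) * indicator {y. x\<^sup>2 + y\<^sup>2 < D} y \<partial>lborel \<partial>lborel)" for D :: real
    by (intro nn_integral_cong) (auto simp: indicator_def add.commute)
  ultimately show "(\<integral>\<^sup>+w. ennreal ((fst (snd w))\<^sup>2) * indicator (heis_ball r (0, 0, 0)) w \<partial>lborel) = ennreal (pi * r ^ 6 / 12)"
    using nn_integral_heis_ball_slices[OF assms meas(2)] by (simp add: slice z)
qed

lemma measure_heis_ball:
  assumes "0 < r"
  shows "measure lborel (heis_ball r q) = pi\<^sup>2 * r ^ 4 / 8"
proof -
  have "(LINT w:heis_ball r q|lborel. 1::real) = (LINT w:heis_ball r (0, 0, 0)|lborel. 1)"
    by (rule set_integral_heis_ball_translate) simp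
  then have "measure lborel (heis_ball r q) = measure lborel (heis_ball r (0, 0, 0))"
    by (simp add: set_lebesgue_integral_def)
  then show ?thesis
    by (simp add: measure_def emeasure_heis_ball_0[OF assms])
qed

lemma set_integral_heis_ball_squares:
  assumes "0 < r"
  shows "(LINT w:heis_ball r (0, 0, 0)|lborel. (fst w)\<^sup>2) = pi * r ^ 6 / 12"
    and "(LINT w:heis_ball r (0, 0, 0)|lborel. (fst (snd w))\<^sup>2) = pi * r ^ 6 / 12"
proof -
  have *: "(LINT w:B|lborel. f w) = c"
    if "(\<integral>\<^sup>+w. ennreal (f w) * indicator B w \<partial>lborel) = ennreal c" "0 \<le> c" "\<And>w. 0 \<le> f w"
      "f \<in> borel_measurable borel" "B \<in> sets borel" for f :: "heis \<Rightarrow> real" and B c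
  proof -
    have [measurable]: "f \<in> borel_measurable borel" "B \<in> sets borel" by fact+
    have "(\<integral>\<^sup>+w. ennreal (indicator B w * f w) \<partial>lborel) = ennreal c"
      using that(1) by (simp add: ennreal_mult'' that(3) ennreal_indicator mult.commute)
    then show ?thesis
      unfolding set_lebesgue_integral_def real_scaleR_def
      using that(2,3) by (subst integral_eq_nn_integral) auto
  qed
  show "(LINT w:heis_ball r (0, 0, 0)|lborel. (fst w)\<^sup>2) = pi * r ^ 6 / 12"
    using assms
    by (intro * nn_integral_heis_ball_squares)
       (auto intro!: borel_measurable_continuous_onI continuous_intros)
  show "(LINT w:heis_ball r (0, 0, 0)|lborel. (fst (snd w))\<^sup>2) = pi * r ^ 6 / 12"
    using assms
    by (intro * nn_integral_heis_ball_squares)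
       (auto intro!: borel_measurable_continuous_onI continuous_intros)
qed

section \<open>Extrema of second-order jets on the Koranyi ball\<close>

text \<open>The monomials of weight at most 2 for the dilations, where \<open>a\<close> and
  \<open>b\<close> have weight 1 and \<open>c\<close> has weight 2. Products such as
  \<open>a c\<close> or \<open>c\<^sup>2\<close> are \<open>O(r^3)\<close> on the ball of radius
  \<open>r\<close> and are left to the error.\<close>

definition heis_jet :: "real \<Rightarrow> real \<Rightarrow> real \<Rightarrow> real \<Rightarrow> real \<Rightarrow> real \<Rightarrow> heis \<Rightarrow> real" where
  "heis_jet A B C P R S = (\<lambda>(a, b, c). A * a + B * b + C * c + (P * a\<^sup>2 + R * (a * b) + S * b\<^sup>2) / 2)"

text \<open>AM-GM weighted so that each use costs only a quarter of \<open>x\<close>: several such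
  terms can then be charged to the same loss.\<close>

lemma le_quarter_add_of_square_le:
  fixes x y e :: real
  assumes "0 \<le> x" "0 \<le> y" "e\<^sup>2 \<le> x * y"
  shows "e \<le> x / 4 + y"
proof (rule power2_le_imp_le)
  have "(x / 4 + y)\<^sup>2 - x * y = (x / 4 - y)\<^sup>2"
    by (simp add: power2_eq_square algebra_simps)
  then show "e\<^sup>2 \<le> (x / 4 + y)\<^sup>2"
    using assms(3) zero_le_power2[of "x / 4 - y"] by linarith
qed (use assms in simp)

text \<open>With \<open>d = r - s\<close> the gauge condition gives \<open>t\<^sup>2 \<le> 2 r d\<close> and \<open>c\<^sup>2 \<le> r\<^sup>3 d / 4\<close>, so by
  AM-GM the loss \<open>N d\<close> absorbs \<open>C c\<close> and the mixed term up to \<open>O(r\<^sup>3)\<close>.\<close>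

lemma aligned_jet_le:
  fixes N C P R S r s t c :: real
  assumes "0 < N" "0 < r" "r * (\<bar>P\<bar> + \<bar>S\<bar> + 1) \<le> N / 4"
    and "(s\<^sup>2 + t\<^sup>2)\<^sup>2 + 16 * c\<^sup>2 < r ^ 4"
  shows "N * s + C * c + (P * s\<^sup>2 + R * (s * t) + S * t\<^sup>2) / 2
    \<le> N * r + r\<^sup>2 * P / 2 + (C\<^sup>2 / (4 * N) + R\<^sup>2 / (2 * N)) * r ^ 3"
proof -
  define d where "d = r - s"
  have *: "(s\<^sup>2 + t\<^sup>2)\<^sup>2 + 16 * c\<^sup>2 < (r\<^sup>2)\<^sup>2"
    using assms(4) by (simp flip: power_mult)
  have st: "s\<^sup>2 + t\<^sup>2 < r\<^sup>2"
    by (rule power2_less_imp_less) (use * zero_le_power2[of c] in \<open>linarith, simp\<close>)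
  then have s2: "s\<^sup>2 < r\<^sup>2"
    using zero_le_power2[of t] by linarith
  then have s: "\<bar>s\<bar> < r"
    using assms(2) power2_less_imp_less[of "\<bar>s\<bar>" r] by simp
  then have d: "0 < d" "d < 2 * r" by (auto simp: d_def)
  have eq: "r\<^sup>2 - s\<^sup>2 = d * (r + s)"
    by (simp add: d_def power2_eq_square algebra_simps)
  have rs: "r\<^sup>2 - s\<^sup>2 \<le> 2 * r * d"
    unfolding eq using d(1) s by (simp add: mult.commute mult_left_mono)
  have t2: "t\<^sup>2 \<le> 2 * r * d" using st rs by linarith
  have "16 * c\<^sup>2 \<le> (r\<^sup>2)\<^sup>2 - (s\<^sup>2)\<^sup>2"
  proof -
    have "(s\<^sup>2)\<^sup>2 \<le> (s\<^sup>2 + t\<^sup>2)\<^sup>2" by (intro power_mono) auto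
    then show ?thesis using * by linarith
  qed
  also have "\<dots> = (r\<^sup>2 - s\<^sup>2) * (r\<^sup>2 + s\<^sup>2)"
    by (simp add: power2_eq_square algebra_simps)
  also have "\<dots> \<le> (2 * r * d) * (2 * r\<^sup>2)"
    using rs s2 d assms(2) by (intro mult_mono) auto
  finally have c2: "c\<^sup>2 \<le> r ^ 3 * d / 4"
    by (simp add: power2_eq_square power3_eq_cube ac_simps)
  \<comment> \<open>The constant is fixed by requiring \<open>N d\<close> times the remainder to
    equal the bound \<open>C^2 r^3 d / 4\<close> on \<open>(C c)^2\<close>; the one for
    \<open>R\<close> below arises in the same way.\<close>
  have C: "C * c \<le> N * d / 4 + C\<^sup>2 / (4 * N) * r ^ 3"
  proof (rule le_quarter_add_of_square_le)
    have "C\<^sup>2 * c\<^sup>2 \<le> C\<^sup>2 * (r ^ 3 * d / 4)"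
      by (intro mult_left_mono c2) simp
    then show "(C * c)\<^sup>2 \<le> N * d * (C\<^sup>2 / (4 * N) * r ^ 3)"
      using assms(1) by (simp add: power_mult_distrib field_simps)
  qed (use assms d in auto)
  have R: "R * (s * t) / 2 \<le> N * d / 4 + R\<^sup>2 / (2 * N) * r ^ 3"
  proof (rule le_quarter_add_of_square_le)
    have "R\<^sup>2 * (s\<^sup>2 * t\<^sup>2) \<le> R\<^sup>2 * (r\<^sup>2 * (2 * r * d))"
      using s2 t2 by (intro mult_left_mono mult_mono) auto
    then show "(R * (s * t) / 2)\<^sup>2 \<le> N * d * (R\<^sup>2 / (2 * N) * r ^ 3)"
      using assms(1) by (simp add: power_mult_distrib power_divide field_simps power2_eq_square power3_eq_cube)
  qed (use assms d in auto)
  \<comment> \<open>These terms are already linear in \<open>d\<close> with a coefficient of order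
    \<open>r\<close>, so the smallness of \<open>r\<close> lets another quarter of
    \<open>N d\<close> absorb them.\<close>
  have "P * (s\<^sup>2 - r\<^sup>2) \<le> \<bar>P\<bar> * (2 * r * d)"
  proof -
    have "P * (s\<^sup>2 - r\<^sup>2) \<le> \<bar>P\<bar> * \<bar>s\<^sup>2 - r\<^sup>2\<bar>"
      by (metis abs_ge_self abs_mult)
    also have "\<dots> \<le> \<bar>P\<bar> * (2 * r * d)"
      using rs s2 by (intro mult_left_mono) auto
    finally show ?thesis .
  qed
  moreover have "S * t\<^sup>2 \<le> \<bar>S\<bar> * (2 * r * d)"
    using t2 by (intro mult_mono) auto
  moreover have "r * (\<bar>P\<bar> + \<bar>S\<bar>) * d \<le> N / 4 * d"
    using assms(2,3) d by (intro mult_right_mono) (auto simp: algebra_simps)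
  moreover have "\<bar>P\<bar> * (2 * r * d) + \<bar>S\<bar> * (2 * r * d) = 2 * (r * (\<bar>P\<bar> + \<bar>S\<bar>) * d)"
    by (simp add: algebra_simps)
  moreover have "N / 4 * d = N * d / 4" by simp
  ultimately have "P * (s\<^sup>2 - r\<^sup>2) / 2 + S * t\<^sup>2 / 2 \<le> N * d / 4"
    by linarith
  moreover have "N * s = N * r - N * d"
    by (simp add: d_def algebra_simps)
  moreover have "0 < N * d" using assms d by simp
  moreover have "(P * s\<^sup>2 + R * (s * t) + S * t\<^sup>2) / 2
      = P * (s\<^sup>2 - r\<^sup>2) / 2 + S * t\<^sup>2 / 2 + R * (s * t) / 2 + r\<^sup>2 * P / 2"
    by (simp add: field_simps)
  ultimately show ?thesis using C R unfolding distrib_right by linarith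
qed

text \<open>A rotation of the horizontal plane preserves the gauge, so the gradient may be turned
  into the first axis, which is the situation of \<open>aligned_jet_le\<close>.\<close>

lemma heis_jet_le:
  fixes A B C P R S :: real
  defines "N \<equiv> sqrt (A\<^sup>2 + B\<^sup>2)"
  assumes "(A, B) \<noteq> (0, 0)"
  shows "\<exists>K\<ge>0. \<exists>r0>0. \<forall>r w. 0 < r \<longrightarrow> r < r0 \<longrightarrow> w \<in> heis_ball r (0, 0, 0) \<longrightarrow>
      heis_jet A B C P R S w \<le> N * r + r\<^sup>2 * ((P * A\<^sup>2 + R * (A * B) + S * B\<^sup>2) / N\<^sup>2) / 2 + K * r ^ 3"
proof -
  have N2: "N\<^sup>2 = A\<^sup>2 + B\<^sup>2" unfolding N_def by simp
  have "0 < A\<^sup>2 + B\<^sup>2" using assms(2) by (auto simp: sum_power2_gt_zero_iff)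
  then have N: "0 < N" by (simp add: N_def)
  \<comment> \<open>Coefficients of the quadratic form in the rotated frame; \<open>P'\<close> is
    its value in the direction of the gradient.\<close>
  define P' where "P' = (P * A\<^sup>2 + R * (A * B) + S * B\<^sup>2) / N\<^sup>2"
  define R' where "R' = (2 * (S - P) * (A * B) + R * (A\<^sup>2 - B\<^sup>2)) / N\<^sup>2"
  define S' where "S' = (P * B\<^sup>2 - R * (A * B) + S * A\<^sup>2) / N\<^sup>2"
  define K where "K = C\<^sup>2 / (4 * N) + R'\<^sup>2 / (2 * N)"
  define r0 where "r0 = N / (4 * (\<bar>P'\<bar> + \<bar>S'\<bar> + 1))"
  show ?thesis
  proof (rule exI[of _ K], rule conjI, goal_cases)
    case 1
    show "0 \<le> K" using N by (simp add: K_def)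
  next
    case 2
    show ?case
    proof (intro exI[of _ r0] conjI allI impI)
      show "0 < r0" using N by (simp add: r0_def add_nonneg_pos)
      fix r :: real and w :: heis
      assume r: "0 < r" "r < r0" and w: "w \<in> heis_ball r (0, 0, 0)"
      obtain a b c where abc: "w = (a, b, c)" by (cases w)
      \<comment> \<open>\<open>s\<close> and \<open>t\<close> are the components of
        \<open>(a, b)\<close> along and across the gradient.\<close>
      define s where "s = (A * a + B * b) / N"
      define t where "t = (A * b - B * a) / N"
      have ab: "a = (A * s - B * t) / N" "b = (B * s + A * t) / N"
      proof -
        have "A * s - B * t = N\<^sup>2 * a / N" "B * s + A * t = N\<^sup>2 * b / N"
          using N unfolding N2 by (simp_all add: s_def t_def field_simps power2_eq_square)
        then show "a = (A * s - B * t) / N" "b = (B * s + A * t) / N"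
          using N by (simp_all add: power2_eq_square)
      qed
      have "s\<^sup>2 + t\<^sup>2 = ((A\<^sup>2 + B\<^sup>2) * (a\<^sup>2 + b\<^sup>2)) / N\<^sup>2"
        by (simp add: s_def t_def power_divide add_divide_distrib[symmetric]) (simp add: power2_eq_square algebra_simps)
      then have "s\<^sup>2 + t\<^sup>2 = a\<^sup>2 + b\<^sup>2"
        using N by (simp flip: N2)
      then have "(s\<^sup>2 + t\<^sup>2)\<^sup>2 + 16 * c\<^sup>2 < r ^ 4"
        using w r(1) by (simp add: abc mem_heis_ball_0)
      moreover have "r * (\<bar>P'\<bar> + \<bar>S'\<bar> + 1) \<le> N / 4"
        using r(2) by (simp add: r0_def field_simps)
      ultimately have "N * s + C * c + (P' * s\<^sup>2 + R' * (s * t) + S' * t\<^sup>2) / 2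
          \<le> N * r + r\<^sup>2 * P' / 2 + K * r ^ 3"
        unfolding K_def using N r by (intro aligned_jet_le)
      moreover have "P * a\<^sup>2 + R * (a * b) + S * b\<^sup>2 = P' * s\<^sup>2 + R' * (s * t) + S' * t\<^sup>2"
      proof -
        have "P * a\<^sup>2 + R * (a * b) + S * b\<^sup>2
            = (P * (A * s - B * t)\<^sup>2 + R * ((A * s - B * t) * (B * s + A * t)) + S * (B * s + A * t)\<^sup>2) / N\<^sup>2"
        proof -
          have "P * (p / N)\<^sup>2 + R * (p / N * (q / N)) + S * (q / N)\<^sup>2 = (P * p\<^sup>2 + R * (p * q) + S * q\<^sup>2) / N\<^sup>2" for p q
            by (simp add: add_divide_distrib power_divide) (simp add: power2_eq_square)
          then show ?thesis unfolding ab(1) ab(2) .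
        qed
        also have "\<dots> = ((P * A\<^sup>2 + R * (A * B) + S * B\<^sup>2) * s\<^sup>2
            + (2 * (S - P) * (A * B) + R * (A\<^sup>2 - B\<^sup>2)) * (s * t)
            + (P * B\<^sup>2 - R * (A * B) + S * A\<^sup>2) * t\<^sup>2) / N\<^sup>2"
          by (rule arg_cong[of _ _ "\<lambda>x. x / N\<^sup>2"]) (simp add: power2_eq_square algebra_simps)
        also have "\<dots> = P' * s\<^sup>2 + R' * (s * t) + S' * t\<^sup>2"
        proof -
          have "(e * x + f * y + g * z) / N\<^sup>2 = e / N\<^sup>2 * x + f / N\<^sup>2 * y + g / N\<^sup>2 * z" for e f g x y z
            by (simp add: add_divide_distrib)
          then show ?thesis unfolding P'_def R'_def S'_def .
        qed
        finally show ?thesis .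
      qed
      moreover have "A * a + B * b = N * s"
        using N by (simp add: s_def)
      ultimately show "heis_jet A B C P R S w \<le> N * r + r\<^sup>2 * ((P * A\<^sup>2 + R * (A * B) + S * B\<^sup>2) / N\<^sup>2) / 2 + K * r ^ 3"
        unfolding P'_def[symmetric] by (simp add: heis_jet_def abc)
    qed
  qed
qed

text \<open>The threshold \<open>r0\<close> is chosen before \<open>f\<close> and \<open>m\<close>,
  since later \<open>f\<close> and \<open>m\<close> vary with \<open>r\<close>.\<close>

lemma Sup_heis_ball_jet:
  fixes A B C P R S \<epsilon> :: real
  assumes "(A, B) \<noteq> (0, 0)" "0 < \<epsilon>"
  shows "\<exists>r0>0. \<forall>r f m. 0 < r \<longrightarrow> r < r0 \<longrightarrow>
      (\<forall>w\<in>heis_ball r (0, 0, 0). \<bar>f w - (m + heis_jet A B C P R S w)\<bar> \<le> \<epsilon> * r\<^sup>2) \<longrightarrow>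
      \<bar>(SUP w\<in>heis_ball r (0, 0, 0). f w) - (m + sqrt (A\<^sup>2 + B\<^sup>2) * r
        + r\<^sup>2 * ((P * A\<^sup>2 + R * (A * B) + S * B\<^sup>2) / (A\<^sup>2 + B\<^sup>2)) / 2)\<bar> \<le> 2 * \<epsilon> * r\<^sup>2"
proof -
  define N where "N = sqrt (A\<^sup>2 + B\<^sup>2)"
  define H where "H = (P * A\<^sup>2 + R * (A * B) + S * B\<^sup>2) / N\<^sup>2"
  have N2: "N\<^sup>2 = A\<^sup>2 + B\<^sup>2" unfolding N_def by simp
  have "0 < A\<^sup>2 + B\<^sup>2" using assms(1) by (auto simp: sum_power2_gt_zero_iff)
  then have N: "0 < N" by (simp add: N_def)
  obtain K r1 where r1: "0 < r1" and K: "0 \<le> K"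
    and jet: "\<forall>r w. 0 < r \<longrightarrow> r < r1 \<longrightarrow> w \<in> heis_ball r (0, 0, 0) \<longrightarrow>
      heis_jet A B C P R S w \<le> N * r + r\<^sup>2 * H / 2 + K * r ^ 3"
    using heis_jet_le[OF assms(1), of C P R S] unfolding N_def[symmetric] H_def[symmetric]
    by (elim exE conjE) (rule that)
  show ?thesis
  \<comment> \<open>Below \<open>\<epsilon> / (K + 1)\<close> the cubic error
    \<open>K * r ^ 3\<close> is at most \<open>\<epsilon> * r\<^sup>2\<close>; with the error of
    \<open>f\<close> this makes the factor 2. Adding 1 covers \<open>K = 0\<close>.\<close>
  proof (intro exI[of _ "min r1 (\<epsilon> / (K + 1))"] conjI allI impI)
    show "0 < min r1 (\<epsilon> / (K + 1))" using r1 K assms by simp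
    fix r m :: real and f :: "heis \<Rightarrow> real"
    assume r: "0 < r" "r < min r1 (\<epsilon> / (K + 1))"
      and f: "\<forall>w\<in>heis_ball r (0, 0, 0). \<bar>f w - (m + heis_jet A B C P R S w)\<bar> \<le> \<epsilon> * r\<^sup>2"
    have "r * (K + 1) < \<epsilon>" using r(2) K by (simp add: field_simps)
    then have "K * r \<le> \<epsilon>" using r(1) by (simp add: algebra_simps)
    then have "K * r * r\<^sup>2 \<le> \<epsilon> * r\<^sup>2" by (rule mult_right_mono) simp
    then have Kr: "K * r ^ 3 \<le> \<epsilon> * r\<^sup>2" by (simp add: power2_eq_square power3_eq_cube)
    have up: "f w \<le> m + N * r + r\<^sup>2 * H / 2 + 2 * \<epsilon> * r\<^sup>2" if "w \<in> heis_ball r (0, 0, 0)" for w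
      using bspec[OF f that] jet[rule_format, OF _ _ that] r Kr by auto
    have pt: "(s * A / N, s * B / N, 0) \<in> heis_ball r (0, 0, 0)" if "s \<in> {0<..<r}" for s
    proof -
      have "(s * A / N)\<^sup>2 + (s * B / N)\<^sup>2 = s\<^sup>2 * (A\<^sup>2 + B\<^sup>2) / N\<^sup>2"
        by (simp add: power_divide power_mult_distrib add_divide_distrib[symmetric] algebra_simps)
      also have "\<dots> = s\<^sup>2" using N by (simp flip: N2)
      finally show ?thesis
        using that r(1) by (simp add: mem_heis_ball_0 flip: power_mult) (simp add: power_strict_mono)
    qed
    have bdd: "bdd_above (f ` heis_ball r (0, 0, 0))"
      using up by (auto intro!: bdd_aboveI)
    have "(SUP w\<in>heis_ball r (0, 0, 0). f w) \<le> m + N * r + r\<^sup>2 * H / 2 + 2 * \<epsilon> * r\<^sup>2"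
      using pt[of "r / 2"] r(1) by (intro cSUP_least up) auto
    moreover have "m + N * r + r\<^sup>2 * H / 2 - \<epsilon> * r\<^sup>2 \<le> (SUP w\<in>heis_ball r (0, 0, 0). f w)"
    \<comment> \<open>The ball is open and the near-optimal point lies on its boundary, so it is
      approached from inside along the gradient ray as \<open>s\<close> tends to
      \<open>r\<close>.\<close>
    proof (rule tendsto_upperbound)
      show "((\<lambda>s. m + N * s + s\<^sup>2 * H / 2 - \<epsilon> * r\<^sup>2) \<longlongrightarrow> m + N * r + r\<^sup>2 * H / 2 - \<epsilon> * r\<^sup>2) (at_left r)"
        by (intro tendsto_intros) auto
      have "m + N * s + s\<^sup>2 * H / 2 - \<epsilon> * r\<^sup>2 \<le> (SUP w\<in>heis_ball r (0, 0, 0). f w)" if "s \<in> {0<..<r}" for s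
      proof -
        have "A * (s * A / N) + B * (s * B / N) = s * N\<^sup>2 / N"
          unfolding N2 by (simp add: add_divide_distrib power2_eq_square algebra_simps)
        then have "N * s = A * (s * A / N) + B * (s * B / N)"
          using N by (simp add: power2_eq_square)
        moreover have "s\<^sup>2 * H = P * (s * A / N)\<^sup>2 + R * ((s * A / N) * (s * B / N)) + S * (s * B / N)\<^sup>2"
          by (simp add: H_def power2_eq_square add_divide_distrib algebra_simps)
        ultimately have "heis_jet A B C P R S (s * A / N, s * B / N, 0) = N * s + s\<^sup>2 * H / 2"
          by (simp add: heis_jet_def)
        then have "m + N * s + s\<^sup>2 * H / 2 - \<epsilon> * r\<^sup>2 \<le> f (s * A / N, s * B / N, 0)"
          using bspec[OF f pt[OF that]] by auto
        also have "\<dots> \<le> (SUP w\<in>heis_ball r (0, 0, 0). f w)"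
          by (rule cSUP_upper[OF pt[OF that] bdd])
        finally show ?thesis .
      qed
      then show "\<forall>\<^sub>F s in at_left r. m + N * s + s\<^sup>2 * H / 2 - \<epsilon> * r\<^sup>2 \<le> (SUP w\<in>heis_ball r (0, 0, 0). f w)"
        using r(1) by (auto simp: eventually_at_left_field intro!: exI[of _ 0])
    qed simp
    moreover have "0 \<le> \<epsilon> * r\<^sup>2" using assms by simp
    ultimately show "\<bar>(SUP w\<in>heis_ball r (0, 0, 0). f w)
        - (m + sqrt (A\<^sup>2 + B\<^sup>2) * r
          + r\<^sup>2 * ((P * A\<^sup>2 + R * (A * B) + S * B\<^sup>2) / (A\<^sup>2 + B\<^sup>2)) / 2)\<bar> \<le> 2 * \<epsilon> * r\<^sup>2"
      unfolding N_def[symmetric] unfolding N2[symmetric] H_def[symmetric] by linarith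
  qed
qed

text \<open>The infimum is minus the supremum of \<open>- f\<close>, whose jet has all coefficients
  negated. The gradient length is unchanged by this while the second-order term changes sign; in the
  sum the terms linear in \<open>r\<close> cancel and the quadratic ones add up.\<close>

lemma Sup_add_Inf_heis_ball_jet:
  fixes A B C P R S \<epsilon> :: real
  assumes "(A, B) \<noteq> (0, 0)" "0 < \<epsilon>"
  shows "\<exists>r0>0. \<forall>r f m. 0 < r \<longrightarrow> r < r0 \<longrightarrow>
      (\<forall>w\<in>heis_ball r (0, 0, 0). \<bar>f w - (m + heis_jet A B C P R S w)\<bar> \<le> \<epsilon> * r\<^sup>2) \<longrightarrow>
      \<bar>(INF w\<in>heis_ball r (0, 0, 0). f w) + (SUP w\<in>heis_ball r (0, 0, 0). f w)
        - (2 * m + r\<^sup>2 * ((P * A\<^sup>2 + R * (A * B) + S * B\<^sup>2) / (A\<^sup>2 + B\<^sup>2)))\<bar> \<le> 4 * \<epsilon> * r\<^sup>2"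
proof -
  let ?H = "(P * A\<^sup>2 + R * (A * B) + S * B\<^sup>2) / (A\<^sup>2 + B\<^sup>2)" and ?N = "sqrt (A\<^sup>2 + B\<^sup>2)"
  have neg: "(- A, - B) \<noteq> (0, 0)" using assms(1) by simp
  obtain r1 where r1: "0 < r1"
    "\<forall>r f m. 0 < r \<longrightarrow> r < r1 \<longrightarrow>
      (\<forall>w\<in>heis_ball r (0, 0, 0). \<bar>f w - (m + heis_jet A B C P R S w)\<bar> \<le> \<epsilon> * r\<^sup>2) \<longrightarrow>
      \<bar>(SUP w\<in>heis_ball r (0, 0, 0). f w) - (m + ?N * r + r\<^sup>2 * ?H / 2)\<bar> \<le> 2 * \<epsilon> * r\<^sup>2"
    using Sup_heis_ball_jet[OF assms, of C P R S] by (elim exE conjE) (rule that)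
  have num: "(- P) * A\<^sup>2 + (- R) * (A * B) + (- S) * B\<^sup>2 = - (P * A\<^sup>2 + R * (A * B) + S * B\<^sup>2)"
    by simp
  have H: "(- (P * A\<^sup>2 + R * (A * B) + S * B\<^sup>2)) / (A\<^sup>2 + B\<^sup>2) = - ?H"
    by (rule minus_divide_left[symmetric])
  obtain r2 where r2: "0 < r2"
    "\<forall>r f m. 0 < r \<longrightarrow> r < r2 \<longrightarrow>
      (\<forall>w\<in>heis_ball r (0, 0, 0). \<bar>f w - (m + heis_jet (- A) (- B) (- C) (- P) (- R) (- S) w)\<bar> \<le> \<epsilon> * r\<^sup>2) \<longrightarrow>
      \<bar>(SUP w\<in>heis_ball r (0, 0, 0). f w) - (m + ?N * r + r\<^sup>2 * (- ?H) / 2)\<bar> \<le> 2 * \<epsilon> * r\<^sup>2"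
    using Sup_heis_ball_jet[OF neg assms(2), of "- C" "- P" "- R" "- S"]
    unfolding power2_minus minus_mult_minus num H by (elim exE conjE) (rule that)
  show ?thesis
  proof (intro exI[of _ "min r1 r2"] conjI allI impI)
    show "0 < min r1 r2" using r1 r2 by simp
    fix r m :: real and f :: "heis \<Rightarrow> real"
    assume r: "0 < r" "r < min r1 r2"
      and f: "\<forall>w\<in>heis_ball r (0, 0, 0). \<bar>f w - (m + heis_jet A B C P R S w)\<bar> \<le> \<epsilon> * r\<^sup>2"
    have jet: "heis_jet (- A) (- B) (- C) (- P) (- R) (- S) w = - heis_jet A B C P R S w" for w
      by (cases w) (simp add: heis_jet_def field_simps)
    define G where "G = r\<^sup>2 * ?H"
    have G: "r\<^sup>2 * (- ?H) = - G" by (simp add: G_def)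
    have "\<bar>(SUP w\<in>heis_ball r (0, 0, 0). f w) - (m + ?N * r + G / 2)\<bar> \<le> 2 * \<epsilon> * r\<^sup>2"
      unfolding G_def using r f by (intro r1(2)[rule_format]) auto
    moreover have "\<bar>(SUP w\<in>heis_ball r (0, 0, 0). - f w) - (- m + ?N * r + (- G) / 2)\<bar> \<le> 2 * \<epsilon> * r\<^sup>2"
      unfolding G[symmetric]
    proof (intro r2(2)[rule_format])
      fix w assume "w \<in> heis_ball r (0, 0, 0)"
      then have "\<bar>f w - (m + heis_jet A B C P R S w)\<bar> \<le> \<epsilon> * r\<^sup>2" using f by blast
      then show "\<bar>- f w - (- m + heis_jet (- A) (- B) (- C) (- P) (- R) (- S) w)\<bar> \<le> \<epsilon> * r\<^sup>2"
        unfolding jet by linarith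
    qed (use r in auto)
    moreover have "(INF w\<in>heis_ball r (0, 0, 0). f w) = - (SUP w\<in>heis_ball r (0, 0, 0). - f w)"
      by (simp add: Inf_real_def image_image)
    ultimately show "\<bar>(INF w\<in>heis_ball r (0, 0, 0). f w) + (SUP w\<in>heis_ball r (0, 0, 0). f w)
        - (2 * m + r\<^sup>2 * ?H)\<bar> \<le> 4 * \<epsilon> * r\<^sup>2"
      unfolding G_def[symmetric] by linarith
  qed
qed

section \<open>Horizontal derivatives\<close>

lemma deriv_axis:
  fixes f :: "heis \<Rightarrow> real"
  assumes "(f has_derivative f') (at (g t))" "(g has_derivative (\<lambda>h. h *\<^sub>R e)) (at t)"
  shows "deriv (\<lambda>s. f (g s)) t = f' e"
proof -
  have "((\<lambda>s. f (g s)) has_derivative (\<lambda>h. f' (h *\<^sub>R e))) (at t)"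
    using has_derivative_compose[OF assms(2) assms(1)] by simp
  then have "((\<lambda>s. f (g s)) has_field_derivative f' e) (at t)"
    by (simp add: has_field_derivative_def linear_cmul[OF has_derivative_linear[OF assms(1)]] mult.commute[of _ "f' e"])
  then show ?thesis by (rule DERIV_imp_deriv)
qed

text \<open>Differentiability at the single point suffices, so the formulas can be iterated: they
  apply to \<open>heis_X v\<close> and to the weighted fields in the p-sub-Laplacian.\<close>

lemma heis_XY_eq_derivative:
  assumes "(f has_derivative f') (at (x, y, z))"
  shows "heis_X f (x, y, z) = f' (1, 0, - y / 2)" "heis_Y f (x, y, z) = f' (0, 1, x / 2)"
proof -
  note lin = has_derivative_linear[OF assms]
  have 1: "((\<lambda>s. (s, y, z)) has_derivative (\<lambda>h. h *\<^sub>R (1, 0, 0))) (at x)"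
    and 2: "((\<lambda>s. (x, s, z)) has_derivative (\<lambda>h. h *\<^sub>R (0, 1, 0))) (at y)"
    and 3: "((\<lambda>s. (x, y, s)) has_derivative (\<lambda>h. h *\<^sub>R (0, 0, 1))) (at z)"
    by (auto intro!: derivative_eq_intros simp: fun_eq_iff zero_prod_def)
  have "f' (1, 0, - y / 2) = f' ((1, 0, 0) + (- y / 2) *\<^sub>R (0, 0, 1))"
    "f' (0, 1, x / 2) = f' ((0, 1, 0) + (x / 2) *\<^sub>R (0, 0, 1))" by simp_all
  then have e: "f' (1, 0, - y / 2) = f' (1, 0, 0) - y / 2 * f' (0, 0, 1)"
    "f' (0, 1, x / 2) = f' (0, 1, 0) + x / 2 * f' (0, 0, 1)"
    unfolding linear_add[OF lin] linear_cmul[OF lin] by simp_all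
  show "heis_X f (x, y, z) = f' (1, 0, - y / 2)" "heis_Y f (x, y, z) = f' (0, 1, x / 2)"
    unfolding heis_X.simps heis_Y.simps e
    using deriv_axis[OF assms 1] deriv_axis[OF assms 2] deriv_axis[OF assms 3] by simp_all
qed

section \<open>Comparison of Koranyi balls with Euclidean balls\<close>

lemma norm_heis_le: "norm ((a, b, c)::heis) \<le> \<bar>a\<bar> + \<bar>b\<bar> + \<bar>c\<bar>"
  using norm_Pair_le[of a "(b, c)"] norm_Pair_le[of b c] by simp

lemma abs_coord_le_norm: "\<bar>a\<bar> \<le> norm ((a, b, c)::heis)" "\<bar>b\<bar> \<le> norm ((a, b, c)::heis)"
  using norm_fst_le[of a "(b, c)"] order_trans[OF norm_fst_le[of b c] norm_snd_le[of "(b, c)" a]] by simp_all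

lemma heis_ball_subset_ball:
  assumes "0 < \<delta>"
  shows "\<exists>r0>0. \<forall>r. r < r0 \<longrightarrow> heis_ball r q \<subseteq> ball q \<delta>"
proof -
  obtain x y z where q: "q = (x, y, z)" by (cases q)
  \<comment> \<open>Each of the three coordinates contributes at most \<open>r\<close> to the
    displacement, and the twist of the group law adds at most
    \<open>(\<bar>x\<bar> + \<bar>y\<bar>) * r\<close>.\<close>
  define M where "M = 3 + \<bar>x\<bar> + \<bar>y\<bar>"
  have M: "0 < M" by (simp add: M_def)
  show ?thesis
  proof (intro exI[of _ "min 1 (\<delta> / M)"] conjI allI impI subsetI)
    show "0 < min 1 (\<delta> / M)" using assms M by simp
    fix r p assume r: "r < min 1 (\<delta> / M)" and p: "p \<in> heis_ball r q"
    \<comment> \<open>The radius is not assumed positive; a nonempty ball forces it to be.\<close>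
    have "0 \<le> koranyi w" for w by (cases w) simp
    then have r0: "0 < r"
      using p unfolding heis_ball_def heis_dist_def by (metis (mono_tags) le_less_trans mem_Collect_eq)
    obtain u where "u \<in> heis_ball r (0, 0, 0)" "p = q \<odot> u"
      using p unfolding heis_ball_eq_image[of r q] by auto
    moreover obtain a b c where u: "u = (a, b, c)" by (cases u)
    ultimately have abc: "\<bar>a\<bar> < r" "\<bar>b\<bar> < r" "\<bar>c\<bar> < r\<^sup>2 / 4" and p: "p = q \<odot> (a, b, c)"
      using heis_ball_0_bounds[OF r0] by auto
    have "r\<^sup>2 \<le> r" using r r0 by (simp add: power2_eq_square mult_left_le)
    then have c: "\<bar>c\<bar> < r" using abc(3) r0 by linarith
    have "\<bar>x * b - y * a\<bar> \<le> \<bar>x\<bar> * r + \<bar>y\<bar> * r"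
    proof -
      have "\<bar>x * b - y * a\<bar> \<le> \<bar>x\<bar> * \<bar>b\<bar> + \<bar>y\<bar> * \<bar>a\<bar>"
        by (metis abs_mult abs_triangle_ineq4)
      also have "\<dots> \<le> \<bar>x\<bar> * r + \<bar>y\<bar> * r"
        using abc by (intro add_mono mult_left_mono) auto
      finally show ?thesis .
    qed
    then have "\<bar>c + (x * b - y * a) / 2\<bar> \<le> r + (\<bar>x\<bar> + \<bar>y\<bar>) * r"
    proof -
      have "\<bar>c + t / 2\<bar> \<le> \<bar>c\<bar> + \<bar>t\<bar>" for t :: real by arith
      moreover assume "\<bar>x * b - y * a\<bar> \<le> \<bar>x\<bar> * r + \<bar>y\<bar> * r"
      ultimately show ?thesis using c unfolding distrib_right
        by (meson add_mono less_imp_le order_trans)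
    qed
    then have "\<bar>a\<bar> + \<bar>b\<bar> + \<bar>c + (x * b - y * a) / 2\<bar> < M * r"
      using abc by (simp add: M_def distrib_right)
    then have "norm (a, b, c + (x * b - y * a) / 2) < M * r"
      using norm_heis_le by (rule le_less_trans[rotated])
    also have "M * r < \<delta>" using r M by (simp add: field_simps)
    finally have "norm (p - q) < \<delta>" by (simp add: p q)
    then show "p \<in> ball q \<delta>" by (simp add: dist_norm norm_minus_commute)
  qed
qed

section \<open>Horizontal derivatives of a twice continuously differentiable function\<close>

locale heis_C2 =
  fixes v :: "heis \<Rightarrow> real" and D :: "heis \<Rightarrow> heis \<Rightarrow>\<^sub>L real"
    and D2 :: "heis \<Rightarrow> heis \<Rightarrow>\<^sub>L heis \<Rightarrow>\<^sub>L real"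
  assumes D: "\<And>q. (v has_derivative blinfun_apply (D q)) (at q)"
    and D2: "\<And>q. (D has_derivative blinfun_apply (D2 q)) (at q)"
    and D2_cont: "continuous_on UNIV D2"
begin

lemma continuous_on_v: "continuous_on S v"
  by (rule has_derivative_continuous_on) (rule has_derivative_at_withinI[OF D])

definition "Xvec = (\<lambda>q::heis. (1::real, 0::real, - fst (snd q) / 2))"
definition "Yvec = (\<lambda>q::heis. (0::real, 1::real, fst q / 2))"

text \<open>\<open>R\<close> is the sum of both mixed derivatives, so the symmetry of the second derivative is never
  needed; in \<open>XYv + YXv\<close> the vertical terms \<open>\<plusminus> Zv / 2\<close> cancel.\<close>

definition "Zv q = D q (0, 0, 1)"
definition "P q = D2 q (Xvec q) (Xvec q)"
definition "S q = D2 q (Yvec q) (Yvec q)"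
definition "R q = D2 q (Xvec q) (Yvec q) + D2 q (Yvec q) (Xvec q)"

lemma heis_X_v: "heis_X v = (\<lambda>q. D q (Xvec q))"
  and heis_Y_v: "heis_Y v = (\<lambda>q. D q (Yvec q))"
  using heis_XY_eq_derivative[OF D] by (auto simp: fun_eq_iff Xvec_def Yvec_def)

text \<open>Product rule: the frame vector \<open>Xvec\<close> varies linearly with the point, and
  its variation is vertical.\<close>

lemma heis_X_v_derivative:
  "(heis_X v has_derivative (\<lambda>h. D q (0, 0, - fst (snd h) / 2) + D2 q h (Xvec q))) (at q)"
proof -
  have "(Xvec has_derivative (\<lambda>h. (0, 0, - fst (snd h) / 2))) (at q)"
    unfolding Xvec_def by (auto intro!: derivative_eq_intros)
  from bounded_bilinear.FDERIV[OF bounded_bilinear_blinfun_apply D2 this]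
  show ?thesis unfolding heis_X_v .
qed

lemma heis_Y_v_derivative:
  "(heis_Y v has_derivative (\<lambda>h. D q (0, 0, fst h / 2) + D2 q h (Yvec q))) (at q)"
proof -
  have "(Yvec has_derivative (\<lambda>h. (0, 0, fst h / 2))) (at q)"
    unfolding Yvec_def by (auto intro!: derivative_eq_intros)
  from bounded_bilinear.FDERIV[OF bounded_bilinear_blinfun_apply D2 this]
  show ?thesis unfolding heis_Y_v .
qed

lemma heis_XY_eq:
  assumes "(f has_derivative f') (at q)"
  shows "heis_X f q = f' (Xvec q)" "heis_Y f q = f' (Yvec q)"
  using heis_XY_eq_derivative[of f f' "fst q" "fst (snd q)" "snd (snd q)"] assms
  by (simp_all add: Xvec_def Yvec_def)

lemma Zv_half: "D q (0, 0, 1 / 2) = Zv q / 2" "D q (0, 0, - 1 / 2) = - Zv q / 2"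
proof -
  have "(0, 0, 1 / 2) = (1 / 2) *\<^sub>R (0::real, 0::real, 1::real)"
    "(0, 0, - 1 / 2) = (- 1 / 2) *\<^sub>R (0::real, 0::real, 1::real)" by simp_all
  then show "D q (0, 0, 1 / 2) = Zv q / 2" "D q (0, 0, - 1 / 2) = - Zv q / 2"
    unfolding Zv_def by (simp_all only: blinfun.scaleR_right) simp_all
qed

text \<open>Each frame field is constant along itself, as \<open>Xvec\<close> depends on
  \<open>y\<close> only and \<open>Yvec\<close> on \<open>x\<close> only. The pure second
  derivatives therefore carry no first-order term.\<close>

lemma second_derivatives:
  "heis_X (heis_X v) q = P q" "heis_Y (heis_Y v) q = S q"
  "heis_X (heis_Y v) q + heis_Y (heis_X v) q = R q"
proof -
  have z: "((0, 0, 0)::heis) = 0" by (simp add: zero_prod_def)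
  show "heis_X (heis_X v) q = P q"
    unfolding heis_XY_eq[OF heis_X_v_derivative] P_def by (simp add: Xvec_def z)
  show "heis_Y (heis_Y v) q = S q"
    unfolding heis_XY_eq[OF heis_Y_v_derivative] S_def by (simp add: Yvec_def z)
  show "heis_X (heis_Y v) q + heis_Y (heis_X v) q = R q"
    unfolding heis_XY_eq[OF heis_X_v_derivative] heis_XY_eq[OF heis_Y_v_derivative] R_def
    using Zv_half[of q] by (simp add: Yvec_def Xvec_def)
qed

definition "H q = (P q * (heis_X v q)\<^sup>2 + R q * (heis_X v q * heis_Y v q) + S q * (heis_Y v q)\<^sup>2)
  / ((heis_X v q)\<^sup>2 + (heis_Y v q)\<^sup>2)"

lemma sublap_v: "sublap v q = P q + S q"
  by (simp add: sublap_def second_derivatives)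

text \<open>Since the gradient norm is positive at \<open>q\<close>, its power is differentiable
  there, and \<open>N powr (p - 2)\<close> factors out of the product rule. What differentiating the
  weight adds is \<open>p - 2\<close> times the second derivative along the gradient.\<close>

lemma p_sublap_v:
  assumes "hgrad v q \<noteq> 0"
  shows "p_sublap p v q / norm (hgrad v q) powr (p - 2) = P q + S q + (p - 2) * H q"
proof -
  define c where "c = p - 2"
  let ?A = "heis_X v" and ?B = "heis_Y v"
  define dA where "dA = (\<lambda>h. D q (0, 0, - fst (snd h) / 2) + D2 q h (Xvec q))"
  define dB where "dB = (\<lambda>h. D q (0, 0, fst h / 2) + D2 q h (Yvec q))"
  have dA: "(?A has_derivative dA) (at q)" and dB: "(?B has_derivative dB) (at q)"
    unfolding dA_def dB_def by (rule heis_X_v_derivative heis_Y_v_derivative)+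
  define N where "N = norm (hgrad v q)"
  have N: "0 < N" using assms by (simp add: N_def)
  have norm_hgrad: "norm (hgrad v w) = sqrt ((?A w)\<^sup>2 + (?B w)\<^sup>2)" for w
    by (simp add: hgrad_def norm_Pair)
  have N2: "N\<^sup>2 = (?A q)\<^sup>2 + (?B q)\<^sup>2"
    by (simp add: N_def norm_hgrad)
  have pos: "0 < (?A q)\<^sup>2 + (?B q)\<^sup>2" using N by (simp flip: N2)
  have half: "(x * (2 * a) + y * (2 * b)) / (2 * s) = (x * a + y * b) / s" for x y a b s :: real
  proof -
    have "x * (2 * a) + y * (2 * b) = 2 * (x * a + y * b)" by (simp only: distrib_left mult.left_commute[of _ 2])
    then show ?thesis by (simp only:) (rule mult_divide_mult_cancel_left, simp)
  qed
  have "((\<lambda>w. sqrt ((?A w)\<^sup>2 + (?B w)\<^sup>2)) has_derivative (\<lambda>h. (?A q * dA h + ?B q * dB h) / N)) (at q)"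
    unfolding N_def norm_hgrad using pos
    by (auto intro!: derivative_eq_intros dA dB simp: fun_eq_iff field_simps half simp del: heis_X.simps heis_Y.simps)
  then have dN: "((\<lambda>w. norm (hgrad v w)) has_derivative (\<lambda>h. (?A q * dA h + ?B q * dB h) / N)) (at q)"
    unfolding norm_hgrad .
  have dNc: "((\<lambda>w. norm (hgrad v w) powr c) has_derivative
      (\<lambda>h. N powr c * (c * (?A q * dA h + ?B q * dB h) / N\<^sup>2))) (at q)"
  proof -
    have "((\<lambda>w. norm (hgrad v w) powr c) has_derivative
        (\<lambda>h. norm (hgrad v q) powr c * (0 * ln (norm (hgrad v q)) + (?A q * dA h + ?B q * dB h) / N * c / norm (hgrad v q)))) (at q)"
      by (rule has_derivative_powr[OF dN has_derivative_const]) (use N in \<open>auto simp: N_def\<close>)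
    then show ?thesis
      unfolding N_def[symmetric] by (simp add: power2_eq_square mult.commute)
  qed
  \<comment> \<open>The logarithmic derivative of the weight \<open>norm (hgrad v w) powr c\<close>
    at \<open>q\<close>.\<close>
  define T where "T h = c * (?A q * dA h + ?B q * dB h) / N\<^sup>2" for h
  have gA: "((\<lambda>w. norm (hgrad v w) powr c * ?A w) has_derivative (\<lambda>h. N powr c * dA h + N powr c * T h * ?A q)) (at q)"
    using has_derivative_mult[OF dNc dA] unfolding N_def[symmetric] T_def .
  have gB: "((\<lambda>w. norm (hgrad v w) powr c * ?B w) has_derivative (\<lambda>h. N powr c * dB h + N powr c * T h * ?B q)) (at q)"
    using has_derivative_mult[OF dNc dB] unfolding N_def[symmetric] T_def .
  have PS: "dA (Xvec q) = P q" "dB (Yvec q) = S q" "dB (Xvec q) + dA (Yvec q) = R q"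
    using second_derivatives[of q] heis_XY_eq[OF dA] heis_XY_eq[OF dB] by simp_all
  have "p_sublap p v q = N powr c * (dA (Xvec q) + dB (Yvec q) + T (Xvec q) * ?A q + T (Yvec q) * ?B q)"
    unfolding p_sublap_def c_def[symmetric] heis_XY_eq[OF gA] heis_XY_eq[OF gB] by (simp add: algebra_simps)
  also have "T (Xvec q) * ?A q + T (Yvec q) * ?B q
      = c * (P q * (?A q)\<^sup>2 + (dB (Xvec q) + dA (Yvec q)) * (?A q * ?B q) + S q * (?B q)\<^sup>2) / N\<^sup>2"
    unfolding T_def PS(1,2)[symmetric] by (simp add: algebra_simps power2_eq_square flip: add_divide_distrib)
  then have "dA (Xvec q) + dB (Yvec q) + T (Xvec q) * ?A q + T (Yvec q) * ?B q = P q + S q + c * H q"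
    unfolding PS H_def N2 by simp
  finally show ?thesis
    using N by (simp add: c_def N_def)
qed

end

section \<open>Averages and the expansions\<close>

lemma avg3_translate:
  assumes "continuous_on UNIV v"
  shows "avg3 v r q = (LINT u:heis_ball r (0, 0, 0)|lborel. v (q \<odot> u)) / measure lborel (heis_ball r q)"
  using set_integral_heis_ball_translate[of v r q] borel_measurable_continuous_onI[OF assms]
  by (simp add: avg3_def)

text \<open>Averaging does not enlarge a uniform error. The comparison function \<open>w\<close>
  lives on the ball at the origin; it will be a jet, or \<open>v\<close> translated to another
  centre.\<close>

lemma avg3_approx:
  fixes v w :: "heis \<Rightarrow> real"
  assumes "0 < r" and v: "continuous_on UNIV v" and w: "continuous_on UNIV w"
    and e: "\<And>u. u \<in> heis_ball r (0, 0, 0) \<Longrightarrow> \<bar>v (q \<odot> u) - w u\<bar> \<le> e"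
  shows "\<bar>avg3 v r q - (LINT u:heis_ball r (0, 0, 0)|lborel. w u) / measure lborel (heis_ball r (0, 0, 0))\<bar> \<le> e"
proof -
  let ?B = "heis_ball r (0, 0, 0)" and ?m = "pi\<^sup>2 * r ^ 4 / 8"
  have m: "measure lborel (heis_ball r p) = ?m" for p
    using assms(1) by (rule measure_heis_ball)
  have "0 < ?m" using assms(1) by simp
  have iv: "set_integrable lborel ?B (\<lambda>u. v (q \<odot> u))" and iw: "set_integrable lborel ?B w"
    and ie: "set_integrable lborel ?B (\<lambda>_. e)"
    by (intro set_integrable_heis_ball assms(1) w continuous_on_const
        continuous_on_compose2[OF v] continuous_on_heis_mult continuous_on_id subset_UNIV)+
  have "\<bar>(LINT u:?B|lborel. v (q \<odot> u)) - (LINT u:?B|lborel. w u)\<bar> = \<bar>LINT u:?B|lborel. v (q \<odot> u) - w u\<bar>"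
    by (simp add: set_integral_diff(2)[OF iv iw])
  also have "\<dots> \<le> (LINT u:?B|lborel. \<bar>v (q \<odot> u) - w u\<bar>)"
    using set_integral_norm_bound[OF set_integral_diff(1)[OF iv iw]] by simp
  also have "\<dots> \<le> (LINT u:?B|lborel. e)"
    by (intro set_integral_mono ie e set_integrable_abs set_integral_diff(1) iv iw)
  also have "\<dots> = e * ?m"
    by (simp add: set_lebesgue_integral_def m)
  finally have "\<bar>(LINT u:?B|lborel. v (q \<odot> u)) - (LINT u:?B|lborel. w u)\<bar> / ?m \<le> e"
    using \<open>0 < ?m\<close> by (simp add: pos_divide_le_eq)
  moreover have "\<bar>x / ?m - y / ?m\<bar> = \<bar>x - y\<bar> / ?m" for x y
    by (simp only: diff_divide_distrib[symmetric] abs_div_pos[OF \<open>0 < ?m\<close>])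
  ultimately show ?thesis
    unfolding avg3_translate[OF v] m by (simp only:)
qed

lemma continuous_heis_jet: "continuous_on UNIV (heis_jet A B C P R S)"
  unfolding heis_jet_def case_prod_beta by (intro continuous_intros) auto

text \<open>\<open>P / 2\<close> times the moment \<open>pi r^6 / 12\<close>, divided by the volume
  \<open>pi^2 r^4 / 8\<close>, is \<open>P r^2 / (3 pi)\<close>; likewise for
  \<open>S\<close>.\<close>

lemma avg_heis_jet:
  assumes "0 < r"
  shows "(LINT u:heis_ball r (0, 0, 0)|lborel. m + heis_jet A B C P R S u) / measure lborel (heis_ball r (0, 0, 0))
    = m + r\<^sup>2 / (3 * pi) * (P + S)"
proof -
  let ?B = "heis_ball r (0, 0, 0)"
  have int: "set_integrable lborel ?B f" if "continuous_on UNIV f" for f :: "heis \<Rightarrow> real"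
    using set_integrable_heis_ball[OF assms that] .
  define l where "l = (\<lambda>u::heis. A * fst u + B * fst (snd u) + C * snd (snd u))"
  define k where "k = (\<lambda>u::heis. R / 2 * (fst u * fst (snd u)))"
  have cont: "continuous_on UNIV l" "continuous_on UNIV k"
    "continuous_on UNIV (\<lambda>u::heis. P / 2 * (fst u)\<^sup>2)" "continuous_on UNIV (\<lambda>u::heis. S / 2 * (fst (snd u))\<^sup>2)"
    "continuous_on UNIV (\<lambda>_::heis. m)"
    unfolding l_def k_def by (intro continuous_intros)+
  \<comment> \<open>The linear part is odd under changing all signs, the mixed term under changing
    the sign of \<open>a\<close> alone.\<close>
  have 1: "(LINT u:?B|lborel. l u) = 0"
    by (rule set_integral_heis_ball_odd[of r _ "-1" "-1" "-1"])
       (use assms borel_measurable_continuous_onI[OF cont(1)] in \<open>auto simp: l_def\<close>)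
  have 2: "(LINT u:?B|lborel. k u) = 0"
    by (rule set_integral_heis_ball_odd[of r _ "-1" 1 1])
       (use assms borel_measurable_continuous_onI[OF cont(2)] in \<open>auto simp: k_def\<close>)
  have "(LINT u:?B|lborel. m + heis_jet A B C P R S u)
      = (LINT u:?B|lborel. m + (l u + (k u + (P / 2 * (fst u)\<^sup>2 + S / 2 * (fst (snd u))\<^sup>2))))"
    by (intro set_lebesgue_integral_cong) (auto simp: heis_jet_def l_def k_def field_simps)
  also have "\<dots> = (LINT u:?B|lborel. m) + ((LINT u:?B|lborel. l u) + ((LINT u:?B|lborel. k u)
      + ((LINT u:?B|lborel. P / 2 * (fst u)\<^sup>2) + (LINT u:?B|lborel. S / 2 * (fst (snd u))\<^sup>2))))"
    by (subst set_integral_add; (intro int continuous_on_add cont)?)+ simp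
  also have "\<dots> = m * measure lborel ?B + (P / 2 * (pi * r ^ 6 / 12) + S / 2 * (pi * r ^ 6 / 12))"
    unfolding 1 2 set_integral_mult_right set_integral_heis_ball_squares[OF assms]
    by (simp add: set_lebesgue_integral_def)
  finally show ?thesis
    using assms by (simp add: measure_heis_ball field_simps power2_eq_square eval_nat_numeral)
qed

text \<open>Continuity of the average in its centre at a fixed radius, from uniform continuity on a
  compact product. It serves the limit \<open>p \<rightarrow> 2\<close>, in which \<open>r\<close>
  stays fixed.\<close>

lemma avg3_near:
  assumes "0 < r" and v: "continuous_on UNIV v" and "0 < e"
  shows "\<exists>\<delta>>0. \<forall>p. dist p q < \<delta> \<longrightarrow> \<bar>avg3 v r p - avg3 v r q\<bar> \<le> e"
proof -
  obtain K where K: "compact K" "heis_ball r (0, 0, 0) \<subseteq> K"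
    using heis_ball_subset_compact[OF assms(1)] .
  have "compact (cball q 1 \<times> K)" by (intro compact_Times K(1) compact_cball)
  moreover have "continuous_on (cball q 1 \<times> K) (\<lambda>x. v (fst x \<odot> snd x))"
    by (intro continuous_on_compose2[OF v] continuous_intros) auto
  ultimately have "uniformly_continuous_on (cball q 1 \<times> K) (\<lambda>x. v (fst x \<odot> snd x))"
    by (intro compact_uniformly_continuous)
  then obtain \<delta> where \<delta>: "\<delta> > 0"
    and unif: "\<And>x x'. \<lbrakk>x \<in> cball q 1 \<times> K; x' \<in> cball q 1 \<times> K; dist x' x < \<delta>\<rbrakk> \<Longrightarrow>
      dist (v (fst x' \<odot> snd x')) (v (fst x \<odot> snd x)) < e"
    using assms(3) unfolding uniformly_continuous_on_def by metis
  show ?thesis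
  proof (intro exI[of _ "min 1 \<delta>"] conjI allI impI)
    show "0 < min 1 \<delta>" using \<delta> by simp
    fix p assume p: "dist p q < min 1 \<delta>"
    have "\<bar>v (p \<odot> u) - v (q \<odot> u)\<bar> \<le> e" if "u \<in> heis_ball r (0, 0, 0)" for u
      using unif[of "(q, u)" "(p, u)"] p that K(2)
      by (auto simp: dist_Pair_Pair dist_real_def dist_commute less_imp_le)
    moreover have "continuous_on UNIV (\<lambda>u. v (q \<odot> u))"
      by (intro continuous_on_compose2[OF v] continuous_intros) auto
    ultimately have "\<bar>avg3 v r p - (LINT u:heis_ball r (0, 0, 0)|lborel. v (q \<odot> u))
        / measure lborel (heis_ball r (0, 0, 0))\<bar> \<le> e"
      by (intro avg3_approx[OF assms(1) v])
    then
    show "\<bar>avg3 v r p - avg3 v r q\<bar> \<le> e"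
      unfolding avg3_translate[OF v, of r q] measure_heis_ball[OF assms(1)]
      .
  qed
qed

section \<open>Taylor expansion along left translations, uniform in the base point\<close>

context heis_C2
begin

text \<open>The Lagrange remainder involves \<open>D2\<close> at a point of the segment from
  \<open>w\<close> to \<open>w + h\<close>; continuity of \<open>D2\<close> at \<open>q\<close>
  allows it to be replaced by \<open>D2 q\<close> for all \<open>w\<close> near \<open>q\<close> at
  once.\<close>

lemma taylor:
  assumes "0 < e"
  shows "\<exists>\<delta>>0. \<forall>w h. dist w q < \<delta> \<longrightarrow> dist (w + h) q < \<delta> \<longrightarrow>
    \<bar>v (w + h) - (v w + D w h + D2 q h h / 2)\<bar> \<le> e * (norm h)\<^sup>2"
proof -
  have "isCont D2 q" using D2_cont continuous_on_eq_continuous_at[of UNIV D2] by blast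
  then obtain \<delta> where \<delta>: "\<delta> > 0" and D2_close: "\<And>w. dist w q < \<delta> \<Longrightarrow> dist (D2 w) (D2 q) < 2 * e"
    using assms unfolding continuous_at_eps_delta by (metis zero_less_mult_iff zero_less_numeral)
  show ?thesis
  proof (intro exI[of _ \<delta>] conjI allI impI)
    fix w h assume w: "dist w q < \<delta>" "dist (w + h) q < \<delta>"
    define diff where "diff k = (\<lambda>t::real. if k = 0 then v (w + t *\<^sub>R h)
      else if k = 1 then D (w + t *\<^sub>R h) h else D2 (w + t *\<^sub>R h) h h)" for k :: nat
    have line: "((\<lambda>t. w + t *\<^sub>R h) has_derivative (\<lambda>s. s *\<^sub>R h)) (at t)" for t
      by (auto intro!: derivative_eq_intros)
    have d0: "((\<lambda>t. v (w + t *\<^sub>R h)) has_real_derivative D (w + t *\<^sub>R h) h) (at t)" for t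
      using has_derivative_compose[OF line D]
      by (simp add: has_field_derivative_def blinfun.scaleR_right mult_commute_abs)
    have d1: "((\<lambda>t. D (w + t *\<^sub>R h) h) has_real_derivative D2 (w + t *\<^sub>R h) h h) (at t)" for t
      using bounded_linear.has_derivative[OF blinfun.bounded_linear_left has_derivative_compose[OF line D2]]
      by (simp add: has_field_derivative_def blinfun.scaleR_right blinfun.scaleR_left mult_commute_abs)
    have "\<exists>t. 0 < t \<and> t < 1 \<and> v (w + 1 *\<^sub>R h) = (\<Sum>m<2. diff m 0 / fact m * 1 ^ m) + diff 2 t / fact 2 * 1 ^ 2"
    proof (rule Maclaurin)
      show "\<forall>m t. m < 2 \<and> 0 \<le> t \<and> t \<le> 1 \<longrightarrow> (diff m has_real_derivative diff (Suc m) t) (at t)"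
        using d0 d1 by (auto simp: diff_def less_2_cases_iff numeral_2_eq_2 less_Suc_eq)
    qed (auto simp: diff_def)
    then obtain t where t: "0 < t" "t < 1" and eq: "v (w + h) = v w + D w h + D2 (w + t *\<^sub>R h) h h / 2"
      by (auto simp: diff_def numeral_2_eq_2)
    \<comment> \<open>Convexity of the ball keeps the intermediate point where \<open>D2\<close> is
      close to \<open>D2 q\<close>.\<close>
    have "w + t *\<^sub>R h = (1 - t) *\<^sub>R w + t *\<^sub>R (w + h)" by (simp add: algebra_simps)
    moreover have "(1 - t) *\<^sub>R w + t *\<^sub>R (w + h) \<in> ball q \<delta>"
      using w t by (intro convexD[OF convex_ball]) (auto simp: dist_commute)
    ultimately have "dist (w + t *\<^sub>R h) q < \<delta>" by (simp add: dist_commute)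
    then have "norm (D2 (w + t *\<^sub>R h) - D2 q) \<le> 2 * e"
      using D2_close by (simp add: dist_norm less_imp_le)
    then have "norm ((D2 (w + t *\<^sub>R h) - D2 q) h h) \<le> 2 * e * norm h * norm h"
      by (meson mult_right_mono norm_blinfun norm_ge_zero order_trans)
    moreover have "(D2 (w + t *\<^sub>R h) - D2 q) h h = D2 (w + t *\<^sub>R h) h h - D2 q h h"
      by (simp add: blinfun.diff_left)
    ultimately have "\<bar>D2 (w + t *\<^sub>R h) h h - D2 q h h\<bar> \<le> 2 * (e * (norm h)\<^sup>2)"
      by (simp add: power2_eq_square algebra_simps)
    then show "\<bar>v (w + h) - (v w + D w h + D2 q h h / 2)\<bar> \<le> e * (norm h)\<^sup>2"
      unfolding eq by linarith
  qed (rule \<delta>)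
qed

text \<open>The displacement is read in two frames. At \<open>q\<close> it is horizontal up to a
  vertical part of size \<open>O(\<delta> r)\<close>, negligible in the quadratic term; at
  \<open>w\<close> its decomposition is exact, so the linear term has no error.\<close>

lemma heis_taylor:
  assumes "0 < e"
  shows "\<exists>\<delta>>0. \<forall>w r u. dist w q < \<delta> \<longrightarrow> 0 < r \<longrightarrow> r < \<delta> \<longrightarrow> u \<in> heis_ball r (0, 0, 0) \<longrightarrow>
    \<bar>v (w \<odot> u) - (v w + heis_jet (heis_X v w) (heis_Y v w) (Zv w) (P q) (R q) (S q) u)\<bar> \<le> e * r\<^sup>2"
proof -
  define M where "M = norm (Xvec q) + norm (Yvec q) + 2"
  define L where "L = norm (D2 q) + 1"
  have M: "2 \<le> M" and L: "1 \<le> L" by (simp_all add: M_def L_def)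
  obtain \<delta>1 where \<delta>1: "0 < \<delta>1" and tay: "\<And>w h. dist w q < \<delta>1 \<Longrightarrow> dist (w + h) q < \<delta>1 \<Longrightarrow>
      \<bar>v (w + h) - (v w + D w h + D2 q h h / 2)\<bar> \<le> e / (2 * M\<^sup>2) * (norm h)\<^sup>2"
    using taylor[of "e / (2 * M\<^sup>2)" q] assms M by auto
  \<comment> \<open>The second bound keeps \<open>w\<close> and \<open>w \<odot> u\<close> within
    \<open>\<delta>1\<close> of \<open>q\<close>; the third makes the cross terms
    \<open>4 L M \<delta> r^2\<close> at most \<open>e r^2\<close>. Half of that and the Taylor
    error \<open>e r^2 / 2\<close> fill the budget.\<close>
  define \<delta> where "\<delta> = min 1 (min (\<delta>1 / (1 + M)) (e / (4 * L * M)))"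
  have \<delta>: "0 < \<delta>" "\<delta> \<le> 1" "\<delta> + M * \<delta> \<le> \<delta>1" "4 * L * M * \<delta> \<le> e"
  proof -
    show "0 < \<delta>" using \<delta>1 assms M L by (simp add: \<delta>_def)
    show "\<delta> \<le> 1" by (simp add: \<delta>_def)
    have "\<delta> \<le> \<delta>1 / (1 + M)" by (simp add: \<delta>_def)
    then show "\<delta> + M * \<delta> \<le> \<delta>1" using M by (simp add: field_simps)
    have "\<delta> \<le> e / (4 * L * M)" by (simp add: \<delta>_def)
    then show "4 * L * M * \<delta> \<le> e" using M L by (simp add: field_simps)
  qed
  show ?thesis
  proof (intro exI[of _ \<delta>] conjI allI impI)
    fix w :: heis and r :: real and u :: heis
    assume w: "dist w q < \<delta>" and r: "0 < r" "r < \<delta>" and u: "u \<in> heis_ball r (0, 0, 0)"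
    obtain a b c where abc: "u = (a, b, c)" by (cases u)
    obtain x y z where xyz: "w = (x, y, z)" by (cases w)
    obtain x0 y0 z0 where q: "q = (x0, y0, z0)" by (cases q)
    have ab: "\<bar>a\<bar> \<le> r" "\<bar>b\<bar> \<le> r" "\<bar>c\<bar> \<le> r\<^sup>2 / 4"
      using heis_ball_0_bounds[OF r(1)] u abc by (auto intro: less_imp_le)
    have "\<bar>x - x0\<bar> \<le> norm (w - q)" "\<bar>y - y0\<bar> \<le> norm (w - q)"
      using abs_coord_le_norm[where a = "x - x0" and b = "y - y0" and c = "z - z0"] by (simp_all add: xyz q)
    then have xy: "\<bar>x - x0\<bar> \<le> \<delta>" "\<bar>y - y0\<bar> \<le> \<delta>"
      using w by (auto simp: dist_norm)
    \<comment> \<open>\<open>g\<close> is horizontal at \<open>q\<close>; \<open>s\<close> collects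
      the vertical coordinate of \<open>u\<close> and the discrepancy between the frames at
      \<open>w\<close> and \<open>q\<close>.\<close>
    define g where "g = a *\<^sub>R Xvec q + b *\<^sub>R Yvec q"
    define s where "s = c + ((x - x0) * b - (y - y0) * a) / 2"
    define h where "h = g + (0, 0, s)"
    have wu: "w \<odot> u = w + h"
      by (simp add: h_def g_def s_def xyz abc q Xvec_def Yvec_def field_simps)
    have "\<bar>(x - x0) * b\<bar> \<le> \<delta> * r" "\<bar>(y - y0) * a\<bar> \<le> \<delta> * r"
      unfolding abs_mult using ab xy \<delta>(1) by (auto intro!: mult_mono)
    moreover have "r\<^sup>2 \<le> \<delta> * r" using r by (simp add: power2_eq_square)
    moreover have "0 \<le> \<delta> * r" using r \<delta>(1) by simp
    moreover have "\<bar>c + (m - n) / 2\<bar> \<le> 2 * d"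
      if "\<bar>m\<bar> \<le> d" "\<bar>n\<bar> \<le> d" "r\<^sup>2 \<le> d" "0 \<le> d" for m n d
    proof -
      have "\<bar>m - n\<bar> \<le> 2 * d" using that(1,2) by linarith
      then have "\<bar>(m - n) / 2\<bar> \<le> d" by simp
      moreover have "\<bar>c\<bar> \<le> d" using ab(3) that(3,4) by linarith
      ultimately show ?thesis by linarith
    qed
    ultimately have s: "\<bar>s\<bar> \<le> 2 * \<delta> * r"
      unfolding s_def mult.assoc by blast
    then have s': "norm (0::real, 0::real, s) \<le> 2 * \<delta> * r"
      using norm_heis_le[of 0 0 s] by simp
    have "norm g \<le> \<bar>a\<bar> * norm (Xvec q) + \<bar>b\<bar> * norm (Yvec q)"
      unfolding g_def by (metis norm_scaleR norm_triangle_ineq)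
    also have "\<dots> \<le> r * norm (Xvec q) + r * norm (Yvec q)"
      using ab by (intro add_mono mult_right_mono) auto
    finally have g0: "norm g \<le> r * norm (Xvec q) + r * norm (Yvec q)" .
    have "\<delta> * r \<le> 1 * r" using \<delta>(2) r by (intro mult_right_mono) auto
    then have h: "norm h \<le> M * r"
      using g0 s' norm_triangle_ineq[of g "(0, 0, s)"] unfolding h_def M_def by (simp add: algebra_simps)
    have g: "norm g \<le> M * r"
      using g0 r unfolding M_def by (simp add: algebra_simps)
    have "M * r \<le> M * \<delta>" using r M by simp
    then have "dist (w + h) q < \<delta>1"
      using w h \<delta>(3) norm_triangle_ineq[of "w - q" h] by (simp add: dist_norm algebra_simps)
    moreover have "dist w q < \<delta>1"
    proof -
      have "0 \<le> M * \<delta>" using M \<delta>(1) by simp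
      then show ?thesis using w \<delta>(3) by linarith
    qed
    ultimately have "\<bar>v (w + h) - (v w + D w h + D2 q h h / 2)\<bar> \<le> e / (2 * M\<^sup>2) * (norm h)\<^sup>2"
      by (rule tay[rotated])
    also have "\<dots> \<le> e / (2 * M\<^sup>2) * (M * r)\<^sup>2"
      using h assms by (intro mult_left_mono power_mono) auto
    also have "\<dots> = e * r\<^sup>2 / 2"
      using M by (simp add: power_mult_distrib)
    finally have 1: "\<bar>v (w + h) - (v w + D w h + D2 q h h / 2)\<bar> \<le> e * r\<^sup>2 / 2" .
    have "D2 q h h - D2 q g g = D2 q g (0, 0, s) + D2 q (0, 0, s) h"
      by (simp add: h_def blinfun.add_left blinfun.add_right)
    also have "norm \<dots> \<le> L * (M * r) * (2 * \<delta> * r) + L * (2 * \<delta> * r) * (M * r)"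
    proof -
      have bound: "norm (D2 q k k') \<le> L * K * K'" if "norm k \<le> K" "norm k' \<le> K'" for k k' K K'
      proof -
        have "0 \<le> K" "0 \<le> K'" using that norm_ge_zero order_trans by blast+
        have "norm (D2 q k k') \<le> norm (D2 q k) * norm k'" by (rule norm_blinfun)
        also have "\<dots> \<le> (norm (D2 q) * norm k) * norm k'"
          by (intro mult_right_mono norm_blinfun) simp
        also have "\<dots> \<le> L * K * K'"
          using that \<open>0 \<le> K\<close> by (intro mult_mono) (auto simp: L_def)
        finally show ?thesis .
      qed
      show ?thesis
        using bound[OF g s'] bound[OF s' h] norm_triangle_ineq by (meson add_mono order_trans)
    qed
    also have "\<dots> = 4 * L * M * \<delta> * r\<^sup>2" by (simp add: power2_eq_square)
    also have "\<dots> \<le> e * r\<^sup>2" using \<delta>(4) by (intro mult_right_mono) auto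
    finally have 2: "\<bar>D2 q h h - D2 q g g\<bar> \<le> e * r\<^sup>2" by simp
    have 3: "D2 q g g = P q * a\<^sup>2 + R q * (a * b) + S q * b\<^sup>2"
      by (simp add: g_def P_def R_def S_def blinfun.add_left blinfun.add_right blinfun.scaleR_left
          blinfun.scaleR_right power2_eq_square algebra_simps)
    \<comment> \<open>In the frame at \<open>w\<close> the discrepancy disappears and the vertical
      coordinate is exactly \<open>c\<close>.\<close>
    have "h = a *\<^sub>R Xvec w + b *\<^sub>R Yvec w + c *\<^sub>R (0, 0, 1)"
      by (simp add: h_def g_def s_def xyz q Xvec_def Yvec_def field_simps)
    then have "D w h = a *\<^sub>R D w (Xvec w) + b *\<^sub>R D w (Yvec w) + c *\<^sub>R D w (0, 0, 1)"
      by (simp only: blinfun.add_right blinfun.scaleR_right)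
    then have 4: "D w h = heis_X v w * a + heis_Y v w * b + Zv w * c"
      by (simp add: heis_X_v heis_Y_v Zv_def)
    show "\<bar>v (w \<odot> u) - (v w + heis_jet (heis_X v w) (heis_Y v w) (Zv w) (P q) (R q) (S q) u)\<bar> \<le> e * r\<^sup>2"
    proof -
      have "\<bar>V - (V0 + (L + F / 2))\<bar> \<le> d"
        if "\<bar>V - (V0 + L + E / 2)\<bar> \<le> d / 2" "\<bar>E - F\<bar> \<le> d" for V V0 L E F d :: real
        using that by linarith
      from this[OF 1 2] show ?thesis
        unfolding wu by (simp add: abc heis_jet_def 3 4)
    qed
  qed (rule \<delta>)
qed

lemma avg3_expansion:
  assumes "0 < e"
  shows "\<exists>\<delta>>0. \<forall>w r. dist w q < \<delta> \<longrightarrow> 0 < r \<longrightarrow> r < \<delta> \<longrightarrow>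
    \<bar>avg3 v r w - (v w + r\<^sup>2 / (3 * pi) * sublap v q)\<bar> \<le> e * r\<^sup>2"
proof -
  obtain \<delta> where "0 < \<delta>" and tay: "\<And>w r u. \<lbrakk>dist w q < \<delta>; 0 < r; r < \<delta>; u \<in> heis_ball r (0, 0, 0)\<rbrakk> \<Longrightarrow>
    \<bar>v (w \<odot> u) - (v w + heis_jet (heis_X v w) (heis_Y v w) (Zv w) (P q) (R q) (S q) u)\<bar> \<le> e * r\<^sup>2"
    using heis_taylor[OF assms, of q] by metis
  show ?thesis
  proof (intro exI[of _ \<delta>] conjI allI impI)
    fix w :: heis and r :: real
    assume w: "dist w q < \<delta>" and r: "0 < r" "r < \<delta>"
    show "\<bar>avg3 v r w - (v w + r\<^sup>2 / (3 * pi) * sublap v q)\<bar> \<le> e * r\<^sup>2"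
      using avg3_approx[OF r(1) continuous_on_v _ tay[OF w r]]
      unfolding avg_heis_jet[OF r(1)] sublap_v
      by (simp add: continuous_on_add continuous_on_const continuous_heis_jet)
  qed fact
qed

end

section \<open>From uniform estimates to the asymptotic expansions\<close>

lemma smallo_square_at_rightI:
  fixes f :: "real \<Rightarrow> real"
  assumes "\<And>e. 0 < e \<Longrightarrow> \<exists>\<delta>>0. \<forall>r. 0 < r \<longrightarrow> r < \<delta> \<longrightarrow> \<bar>f r\<bar> \<le> e * r\<^sup>2"
  shows "f \<in> o[at_right 0](\<lambda>r. r\<^sup>2)"
proof (rule landau_o.smallI)
  fix e :: real assume "0 < e"
  then obtain \<delta> where "0 < \<delta>" "\<forall>r. 0 < r \<longrightarrow> r < \<delta> \<longrightarrow> \<bar>f r\<bar> \<le> e * r\<^sup>2"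
    using assms by metis
  then show "\<forall>\<^sub>F r in at_right 0. norm (f r) \<le> e * norm (r\<^sup>2)"
    unfolding eventually_at_right_field by (intro exI[of _ \<delta>]) auto
qed

lemma smallo_cmult:
  fixes f :: "'a \<Rightarrow> real"
  assumes "f \<in> o[F](g)"
  shows "(\<lambda>x. c * f x) \<in> o[F](g)"
  using assms by (cases "c = 0") simp_all

lemma center_mem_heis_ball: "0 < r \<Longrightarrow> q \<in> heis_ball r q"
  by (simp add: heis_ball_def heis_dist_def heis_inverse)

context heis_C2
begin

text \<open>Covers both expansions: \<open>F\<close> may depend on \<open>r\<close> as long as it
  follows \<open>v\<close> up to a shift \<open>m r - v q\<close> that is constant on the ball. That
  shift passes through the extrema, leaving the jet of \<open>v\<close> at \<open>q\<close>.\<close>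

lemma Inf_add_Sup_expansion:
  assumes "hgrad v q \<noteq> 0" "0 < e"
    and F: "\<And>e. 0 < e \<Longrightarrow> \<exists>\<delta>>0. \<forall>r p. 0 < r \<longrightarrow> r < \<delta> \<longrightarrow> p \<in> heis_ball r q \<longrightarrow>
      \<bar>F r p - (m r + (v p - v q))\<bar> \<le> e * r\<^sup>2"
  shows "\<exists>\<delta>>0. \<forall>r. 0 < r \<longrightarrow> r < \<delta> \<longrightarrow>
    \<bar>(INF p\<in>heis_ball r q. F r p) + (SUP p\<in>heis_ball r q. F r p) - (2 * m r + r\<^sup>2 * H q)\<bar> \<le> e * r\<^sup>2"
proof -
  have nz: "(heis_X v q, heis_Y v q) \<noteq> (0, 0)"
    using assms(1) by (simp add: hgrad_def zero_prod_def)
  have e: "0 < e / 8" "0 < e / 4" using assms(2) by simp_all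
  obtain \<delta>1 where \<delta>1: "0 < \<delta>1" and F': "\<forall>r p. 0 < r \<longrightarrow> r < \<delta>1 \<longrightarrow> p \<in> heis_ball r q \<longrightarrow>
      \<bar>F r p - (m r + (v p - v q))\<bar> \<le> e / 8 * r\<^sup>2"
    using F[OF e(1)] by blast
  let ?J = "heis_jet (heis_X v q) (heis_Y v q) (Zv q) (P q) (R q) (S q)"
  obtain \<delta>2 where \<delta>2: "0 < \<delta>2" and tay: "\<forall>w r u. dist w q < \<delta>2 \<longrightarrow> 0 < r \<longrightarrow> r < \<delta>2 \<longrightarrow>
      u \<in> heis_ball r (0, 0, 0) \<longrightarrow>
      \<bar>v (w \<odot> u) - (v w + heis_jet (heis_X v w) (heis_Y v w) (Zv w) (P q) (R q) (S q) u)\<bar> \<le> e / 8 * r\<^sup>2"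
    using heis_taylor[OF e(1), of q] by blast
  obtain \<delta>3 where \<delta>3: "0 < \<delta>3" and ext: "\<forall>r f m. 0 < r \<longrightarrow> r < \<delta>3 \<longrightarrow>
      (\<forall>w\<in>heis_ball r (0, 0, 0). \<bar>f w - (m + ?J w)\<bar> \<le> e / 4 * r\<^sup>2) \<longrightarrow>
      \<bar>(INF w\<in>heis_ball r (0, 0, 0). f w) + (SUP w\<in>heis_ball r (0, 0, 0). f w)
        - (2 * m + r\<^sup>2 * H q)\<bar> \<le> 4 * (e / 4) * r\<^sup>2"
    using Sup_add_Inf_heis_ball_jet[OF nz e(2), of "Zv q" "P q" "R q" "S q"]
    unfolding H_def[symmetric] by blast
  show ?thesis
  proof (intro exI[of _ "min \<delta>1 (min \<delta>2 \<delta>3)"] conjI allI impI)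
    show "0 < min \<delta>1 (min \<delta>2 \<delta>3)" using \<delta>1 \<delta>2 \<delta>3 by simp
    fix r :: real
    assume r: "0 < r" "r < min \<delta>1 (min \<delta>2 \<delta>3)"
    have "\<bar>F r (q \<odot> u) - (m r + ?J u)\<bar> \<le> e / 4 * r\<^sup>2" if "u \<in> heis_ball r (0, 0, 0)" for u
    proof -
      have "\<bar>v (q \<odot> u) - (v q + ?J u)\<bar> \<le> e / 8 * r\<^sup>2"
        using tay[rule_format, of q r u] r that \<delta>2 by simp
      moreover have "\<bar>F r (q \<odot> u) - (m r + (v (q \<odot> u) - v q))\<bar> \<le> e / 8 * r\<^sup>2"
        using F'[rule_format, of r "q \<odot> u"] r that by simp
      moreover have "e / 8 * r\<^sup>2 + e / 8 * r\<^sup>2 = e / 4 * r\<^sup>2" by simp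
      ultimately show ?thesis by linarith
    qed
    then have "\<bar>(INF u\<in>heis_ball r (0, 0, 0). F r (q \<odot> u)) + (SUP u\<in>heis_ball r (0, 0, 0). F r (q \<odot> u))
        - (2 * m r + r\<^sup>2 * H q)\<bar> \<le> 4 * (e / 4) * r\<^sup>2"
      using r by (intro ext[rule_format]) auto
    then show "\<bar>(INF p\<in>heis_ball r q. F r p) + (SUP p\<in>heis_ball r q. F r p) - (2 * m r + r\<^sup>2 * H q)\<bar> \<le> e * r\<^sup>2"
      unfolding heis_ball_eq_image[of r q] image_image by simp
  qed
qed

lemma avg3_smallo:
  "(\<lambda>r. avg3 v r q - (v q + r\<^sup>2 / (3 * pi) * sublap v q)) \<in> o[at_right 0](\<lambda>r. r\<^sup>2)"
proof (rule smallo_square_at_rightI)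
  fix e :: real assume "0 < e"
  from avg3_expansion[OF this, of q]
  show "\<exists>\<delta>>0. \<forall>r. 0 < r \<longrightarrow> r < \<delta> \<longrightarrow> \<bar>avg3 v r q - (v q + r\<^sup>2 / (3 * pi) * sublap v q)\<bar> \<le> e * r\<^sup>2"
    by (metis dist_self)
qed

text \<open>The weights satisfy \<open>alpha_p + beta_p = 1\<close>, which preserves
  \<open>v q\<close>. For \<open>p < 2\<close> the coefficient \<open>beta_p\<close> is negative,
  which is harmless because the two expansions are combined linearly.\<close>

lemma mean_i_smallo:
  assumes "hgrad v q \<noteq> 0" "1 < p"
  shows "(\<lambda>r. mean_i p v r q - (v q + r\<^sup>2 / (2 * (p - 2) + 3 * pi)
      * (p_sublap p v q / norm (hgrad v q) powr (p - 2)))) \<in> o[at_right 0](\<lambda>r. r\<^sup>2)"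
proof -
  define T where "T = 2 * (p - 2) + 3 * pi"
  \<comment> \<open>From \<open>1 < p\<close> one gets \<open>T > 3 pi - 2\<close>, which is
    positive.\<close>
  have T: "0 < T" using assms(2) pi_gt3 by (simp add: T_def)
  have "(\<lambda>r. (INF p\<in>heis_ball r q. v p) + (SUP p\<in>heis_ball r q. v p) - (2 * v q + r\<^sup>2 * H q))
      \<in> o[at_right 0](\<lambda>r. r\<^sup>2)"
  proof (rule smallo_square_at_rightI)
    fix e :: real assume "0 < e"
    show "\<exists>\<delta>>0. \<forall>r. 0 < r \<longrightarrow> r < \<delta> \<longrightarrow>
        \<bar>(INF p\<in>heis_ball r q. v p) + (SUP p\<in>heis_ball r q. v p) - (2 * v q + r\<^sup>2 * H q)\<bar> \<le> e * r\<^sup>2"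
      by (rule Inf_add_Sup_expansion[OF assms(1) \<open>0 < e\<close>]) (auto intro!: exI[of _ 1])
  qed
  then have "(\<lambda>r. 3 * pi / T * (avg3 v r q - (v q + r\<^sup>2 / (3 * pi) * sublap v q)) + (p - 2) / T *
      ((INF p\<in>heis_ball r q. v p) + (SUP p\<in>heis_ball r q. v p) - (2 * v q + r\<^sup>2 * H q)))
      \<in> o[at_right 0](\<lambda>r. r\<^sup>2)"
    by (intro sum_in_smallo(1) smallo_cmult avg3_smallo)
  also have "(\<lambda>r. 3 * pi / T * (avg3 v r q - (v q + r\<^sup>2 / (3 * pi) * sublap v q)) + (p - 2) / T *
      ((INF p\<in>heis_ball r q. v p) + (SUP p\<in>heis_ball r q. v p) - (2 * v q + r\<^sup>2 * H q)))
      = (\<lambda>r. mean_i p v r q - (v q + r\<^sup>2 / (2 * (p - 2) + 3 * pi)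
      * (p_sublap p v q / norm (hgrad v q) powr (p - 2))))"
  proof
    fix r
    define a b where "a = 3 * pi / T" and "b = (p - 2) / T"
    define I where "I = (INF p\<in>heis_ball r q. v p) + (SUP p\<in>heis_ball r q. v p)"
    have "(3 * pi * v q + (p - 2) * (2 * v q)) / T = T * v q / T"
      unfolding T_def by (simp add: algebra_simps)
    then have ab: "a * v q + b * (2 * v q) = v q"
      using T by (simp add: add_divide_distrib a_def b_def)
    have L: "a * (r\<^sup>2 / (3 * pi) * sublap v q) = r\<^sup>2 / T * sublap v q"
      by (simp add: a_def)
    have H: "r\<^sup>2 / T * ((p - 2) * H q) = b * (r\<^sup>2 * H q)"
      by (simp add: b_def)
    have "2 * x / T / 2 = x / T" for x by simp
    then have b: "2 * (p - 2) / T / 2 = b" unfolding b_def .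
    show "3 * pi / T * (avg3 v r q - (v q + r\<^sup>2 / (3 * pi) * sublap v q)) + (p - 2) / T *
      ((INF p\<in>heis_ball r q. v p) + (SUP p\<in>heis_ball r q. v p) - (2 * v q + r\<^sup>2 * H q))
      = mean_i p v r q - (v q + r\<^sup>2 / (2 * (p - 2) + 3 * pi)
      * (p_sublap p v q / norm (hgrad v q) powr (p - 2)))"
      unfolding mean_i_def alpha_p_def beta_p_def p_sublap_v[OF assms(1)] sublap_v[symmetric] T_def[symmetric]
        I_def[symmetric] b a_def[symmetric] b_def[symmetric] distrib_left[of "r\<^sup>2 / T"] H
      unfolding right_diff_distrib distrib_left L using ab by linarith
  qed
  finally show ?thesis .
qed

text \<open>The radius \<open>s = g r\<close> of the extremal ball is taken as the running
  parameter, so the averages have radius \<open>s / g\<close>. The three averages together restore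
  the full sub-Laplacian term, while \<open>g\<^sup>2 = (p - 2) / pi\<close> gives the gradient
  direction its factor \<open>p - 2\<close>.\<close>

lemma mean_ii_smallo:
  assumes "hgrad v q \<noteq> 0" "2 < p"
  shows "(\<lambda>r. mean_ii p v r q - (v q + r\<^sup>2 / (3 * pi)
      * (p_sublap p v q / norm (hgrad v q) powr (p - 2)))) \<in> o[at_right 0](\<lambda>r. r\<^sup>2)"
proof -
  define g where "g = gamma_p p"
  have g: "0 < g" "g\<^sup>2 = (p - 2) / pi"
    using assms(2) by (simp_all add: g_def gamma_p_def)
  let ?E = "\<lambda>r. (INF p\<in>heis_ball (g * r) q. avg3 v r p) + (SUP p\<in>heis_ball (g * r) q. avg3 v r p)"
  have "(\<lambda>r. ?E r - (2 * (v q + r\<^sup>2 / (3 * pi) * sublap v q) + (g * r)\<^sup>2 * H q)) \<in> o[at_right 0](\<lambda>r. r\<^sup>2)"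
  proof (rule smallo_square_at_rightI)
    fix e :: real assume "0 < e"
    define m where "m s = v q + (s / g)\<^sup>2 / (3 * pi) * sublap v q" for s
    have "\<exists>\<delta>>0. \<forall>s w. 0 < s \<longrightarrow> s < \<delta> \<longrightarrow> w \<in> heis_ball s q \<longrightarrow>
        \<bar>avg3 v (s / g) w - (m s + (v w - v q))\<bar> \<le> e' * s\<^sup>2" if "0 < e'" for e'
    proof -
      \<comment> \<open>Tolerance scaled by \<open>g\<^sup>2\<close>, because
        \<open>(s / g)\<^sup>2\<close> has to become \<open>s\<^sup>2\<close>; the later
        \<open>e / g\<^sup>2\<close> undoes the substitution in the other direction.\<close>
      have "0 < e' * g\<^sup>2" using that g(1) by simp
      from avg3_expansion[OF this, of q]
      obtain \<delta> where \<delta>: "0 < \<delta>" and avg: "\<And>w r. \<lbrakk>dist w q < \<delta>; 0 < r; r < \<delta>\<rbrakk> \<Longrightarrow>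
          \<bar>avg3 v r w - (v w + r\<^sup>2 / (3 * pi) * sublap v q)\<bar> \<le> e' * g\<^sup>2 * r\<^sup>2"
        by metis
      obtain r0 where r0: "0 < r0" "\<And>r. r < r0 \<Longrightarrow> heis_ball r q \<subseteq> ball q \<delta>"
        using heis_ball_subset_ball[OF \<delta>, of q] by metis
      show ?thesis
      proof (intro exI[of _ "min r0 (\<delta> * g)"] conjI allI impI)
        show "0 < min r0 (\<delta> * g)" using r0 \<delta> g by simp
        fix s w assume s: "0 < s" "s < min r0 (\<delta> * g)" and w: "w \<in> heis_ball s q"
        have "dist w q < \<delta>" using r0(2)[of s] s w by (auto simp: dist_commute)
        moreover have "0 < s / g" "s / g < \<delta>" using s g(1) by (simp_all add: pos_divide_less_eq)
        ultimately have "\<bar>avg3 v (s / g) w - (v w + (s / g)\<^sup>2 / (3 * pi) * sublap v q)\<bar> \<le> e' * g\<^sup>2 * (s / g)\<^sup>2"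
          by (rule avg)
        also have "e' * g\<^sup>2 * (s / g)\<^sup>2 = e' * s\<^sup>2" using g(1) by (simp add: power_divide)
        finally show "\<bar>avg3 v (s / g) w - (m s + (v w - v q))\<bar> \<le> e' * s\<^sup>2"
          by (simp add: m_def algebra_simps)
      qed
    qed
    from Inf_add_Sup_expansion[OF assms(1) _ this, of "e / g\<^sup>2"] \<open>0 < e\<close> g(1)
    obtain \<delta> where \<delta>: "0 < \<delta>" and E: "\<And>s. \<lbrakk>0 < s; s < \<delta>\<rbrakk> \<Longrightarrow>
        \<bar>(INF p\<in>heis_ball s q. avg3 v (s / g) p) + (SUP p\<in>heis_ball s q. avg3 v (s / g) p)
          - (2 * m s + s\<^sup>2 * H q)\<bar> \<le> e / g\<^sup>2 * s\<^sup>2"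
      by (metis zero_less_divide_iff zero_less_power)
    show "\<exists>\<delta>>0. \<forall>r. 0 < r \<longrightarrow> r < \<delta> \<longrightarrow>
        \<bar>?E r - (2 * (v q + r\<^sup>2 / (3 * pi) * sublap v q) + (g * r)\<^sup>2 * H q)\<bar> \<le> e * r\<^sup>2"
    proof (intro exI[of _ "\<delta> / g"] conjI allI impI)
      show "0 < \<delta> / g" using \<delta> g by simp
      fix r :: real assume r: "0 < r" "r < \<delta> / g"
      have "0 < g * r" "g * r < \<delta>" using r g(1) by (simp_all add: pos_less_divide_eq mult.commute)
      moreover have "g * r / g = r" "e / g\<^sup>2 * (g * r)\<^sup>2 = e * r\<^sup>2"
        using g(1) by (simp_all add: power_mult_distrib)
      ultimately show "\<bar>?E r - (2 * (v q + r\<^sup>2 / (3 * pi) * sublap v q) + (g * r)\<^sup>2 * H q)\<bar> \<le> e * r\<^sup>2"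
        using E[of "g * r"] by (simp add: m_def)
    qed
  qed
  then have "(\<lambda>r. 1 / 3 * (avg3 v r q - (v q + r\<^sup>2 / (3 * pi) * sublap v q)) + 1 / 3 *
      (?E r - (2 * (v q + r\<^sup>2 / (3 * pi) * sublap v q) + (g * r)\<^sup>2 * H q))) \<in> o[at_right 0](\<lambda>r. r\<^sup>2)"
    by (intro sum_in_smallo(1) smallo_cmult avg3_smallo)
  also have "(\<lambda>r. 1 / 3 * (avg3 v r q - (v q + r\<^sup>2 / (3 * pi) * sublap v q)) + 1 / 3 *
      (?E r - (2 * (v q + r\<^sup>2 / (3 * pi) * sublap v q) + (g * r)\<^sup>2 * H q)))
      = (\<lambda>r. mean_ii p v r q - (v q + r\<^sup>2 / (3 * pi)
      * (p_sublap p v q / norm (hgrad v q) powr (p - 2))))"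
  proof
    fix r
    define X where "X = r\<^sup>2 / (3 * pi)"
    have gr: "(g * r)\<^sup>2 = 3 * (X * (p - 2))"
      by (simp add: power_mult_distrib g(2) X_def)
    show "1 / 3 * (avg3 v r q - (v q + r\<^sup>2 / (3 * pi) * sublap v q)) + 1 / 3 *
      (?E r - (2 * (v q + r\<^sup>2 / (3 * pi) * sublap v q) + (g * r)\<^sup>2 * H q))
      = mean_ii p v r q - (v q + r\<^sup>2 / (3 * pi) * (p_sublap p v q / norm (hgrad v q) powr (p - 2)))"
      unfolding mean_ii_def p_sublap_v[OF assms(1)] sublap_v[symmetric] g_def[symmetric] X_def[symmetric] gr
      by (simp add: algebra_simps)
  qed
  finally show ?thesis .
qed

text \<open>At fixed \<open>r\<close> the radius \<open>gamma_p p * r\<close> shrinks to 0, and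
  continuity of the average squeezes both extrema to the value at the centre.\<close>

lemma mean_ii_tendsto:
  assumes "0 < r"
  shows "((\<lambda>p. mean_ii p v r q) \<longlongrightarrow> avg3 v r q) (at_right 2)"
proof (rule tendstoI)
  fix e :: real assume "0 < e"
  let ?G = "avg3 v r"
  obtain \<delta> where \<delta>: "0 < \<delta>" "\<And>w. dist w q < \<delta> \<Longrightarrow> \<bar>?G w - ?G q\<bar> \<le> e / 2"
    using avg3_near[OF assms continuous_on_v, of "e / 2" q] \<open>0 < e\<close> by auto
  obtain r0 where r0: "0 < r0" "\<And>s. s < r0 \<Longrightarrow> heis_ball s q \<subseteq> ball q \<delta>"
    using heis_ball_subset_ball[OF \<delta>(1), of q] by metis
  have "((\<lambda>p. gamma_p p * r) \<longlongrightarrow> sqrt ((2 - 2) / pi) * r) (at_right 2)"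
    unfolding gamma_p_def by (intro tendsto_intros) auto
  then have "\<forall>\<^sub>F p in at_right 2. gamma_p p * r < r0"
    by (rule order_tendstoD(2)) (simp add: r0)
  moreover have "\<forall>\<^sub>F p in at_right (2::real). 2 < p"
    by (simp add: eventually_at_right_less)
  ultimately show "\<forall>\<^sub>F p in at_right 2. dist (mean_ii p v r q) (?G q) < e"
  proof eventually_elim
    case (elim p)
    let ?B = "heis_ball (gamma_p p * r) q"
    have "0 < gamma_p p * r" using elim assms by (simp add: gamma_p_def)
    then have ne: "?B \<noteq> {}" using center_mem_heis_ball by blast
    have G: "?G q - e / 2 \<le> ?G w" "?G w \<le> ?G q + e / 2" if "w \<in> ?B" for w
    proof -
      have "dist w q < \<delta>"
        using r0(2)[OF elim(1)] that by (auto simp: dist_commute)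
      from \<delta>(2)[OF this] show "?G q - e / 2 \<le> ?G w" "?G w \<le> ?G q + e / 2" by linarith+
    qed
    obtain w where w: "w \<in> ?B" using ne by blast
    \<comment> \<open>Real \<open>INF\<close> and \<open>SUP\<close> obey the order bounds only for
      nonempty bounded images, hence both facts are established first.\<close>
    have bdd: "bdd_above (?G ` ?B)" "bdd_below (?G ` ?B)"
      using G by (auto intro!: bdd_aboveI bdd_belowI)
    have "?G q - e / 2 \<le> (INF w\<in>?B. ?G w)" "(SUP w\<in>?B. ?G w) \<le> ?G q + e / 2"
      using ne G by (auto intro!: cINF_greatest cSUP_least)
    moreover have "(INF w\<in>?B. ?G w) \<le> ?G q + e / 2" "?G q - e / 2 \<le> (SUP w\<in>?B. ?G w)"
      using cINF_lower[OF bdd(2) w] cSUP_upper[OF w bdd(1)] G[OF w] by linarith+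
    ultimately show ?case
      using \<open>0 < e\<close> unfolding mean_ii_def dist_real_def by linarith
  qed
qed

end

text \<open>The exponent 2 is an admissible value in the first expansion but only a limit in the
  second: there the extremal ball would have radius \<open>gamma_p 2 * r = 0\<close> and be
  empty.\<close>

theorem theorem4p1:
  fixes v :: "heis \<Rightarrow> real" and q :: heis
  assumes "C2_fun v"
    and "hgrad v q \<noteq> 0"
  shows
    "(\<forall>p>1. (\<lambda>r. mean_i p v r q
               - (v q + r\<^sup>2 / (2 * (p - 2) + 3 * pi)
                         * (p_sublap p v q / norm (hgrad v q) powr (p - 2))))
             \<in> o[at_right 0](\<lambda>r. r\<^sup>2))
     \<and> (\<forall>r>0. mean_i 2 v r q = avg3 v r q)
     \<and> p_sublap 2 v q / norm (hgrad v q) powr (2 - 2) = sublap v q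
     \<and> harmonic_expansion v q
     \<and> (\<forall>p>2. (\<lambda>r. mean_ii p v r q
               - (v q + r\<^sup>2 / (3 * pi)
                         * (p_sublap p v q / norm (hgrad v q) powr (p - 2))))
             \<in> o[at_right 0](\<lambda>r. r\<^sup>2))
     \<and> (\<forall>r>0. ((\<lambda>p. mean_ii p v r q) \<longlongrightarrow> avg3 v r q) (at_right 2))
     \<and> ((\<lambda>p. p_sublap p v q / norm (hgrad v q) powr (p - 2)) \<longlongrightarrow> sublap v q) (at_right 2)"
proof -
  obtain D D2 where "\<forall>q. (v has_derivative blinfun_apply (D q)) (at q)"
    "\<forall>q. (D has_derivative blinfun_apply (D2 q)) (at q)" "continuous_on UNIV D2"
    using assms(1) unfolding C2_fun_def by blast
  then interpret heis_C2 v D D2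
    by unfold_locales auto
  note p_sublap = p_sublap_v[OF assms(2)]
  \<comment> \<open>The normalized operator is affine in \<open>p\<close>, so its limit at 2 is its
    value there.\<close>
  have "((\<lambda>p. P q + S q + (p - 2) * H q) \<longlongrightarrow> P q + S q + (2 - 2) * H q) (at_right 2)"
    by (intro tendsto_intros)
  then have lim: "((\<lambda>p. p_sublap p v q / norm (hgrad v q) powr (p - 2)) \<longlongrightarrow> sublap v q) (at_right 2)"
    unfolding p_sublap by (simp add: sublap_v)
  have "mean_i 2 v r q = avg3 v r q" for r
    by (simp add: mean_i_def alpha_p_def beta_p_def)
  moreover have "p_sublap 2 v q / norm (hgrad v q) powr (2 - 2) = sublap v q"
    unfolding p_sublap by (simp add: sublap_v)
  ultimately show ?thesis
    using mean_i_smallo[OF assms(2)] mean_ii_smallo[OF assms(2)] mean_ii_tendsto[of _ q] avg3_smallo[of q] lim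
    unfolding harmonic_expansion_def by blast
qed

end
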